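(* Let $H$ be a hereditary and saturated point functor. Then: 1. $\mathrm{ext}(H)$ is a hereditary and saturated point functor. 2. $\mathrm{Ann}(I(H(E)))=I(\mathrm{ext}(H)(E))$ for every graph $E$. 3. $\mathrm{ext}(\mathrm{ext}(H))$ is a hereditary and saturated point functor and $\mathrm{Ann}(\mathrm{Ann}(I(H(E))))=I(\mathrm{ext}(\mathrm{ext}(H))(E))$ for every graph $E$. 4. $\mathrm{ext}(\mathrm{ext}(H))(E)\subseteq\{v\in E^0 \;\vert\; v\ge H(E)\}$ for every graph $E$. 5. $H(E)\subseteq \mathrm{ext}(\mathrm{ext}(H))(E)$ for every graph $E$. 6. For every graph $E$: $\mathrm{ext}(\mathrm{ext}(H))(E)\subseteq H(E)$ if and only if every $v\in E^0$ satisfying $v\not\ge w$ for all $w\in E^0$ with $w\not\ge H(E)$ belongs to $H(E)$. 7. Let $f\colon L_K(E)\to L_K(F)$ be a ring isomorphism. If $H_1,H_2$ are hereditary and saturated point functors and $H_1$ is $f$-related to $H_2$, then $\mathrm{ext}(H_1)$ is $f$-related to $\mathrm{ext}(H_2)$. In particular, if a hereditary and saturated point functor $H$ is $f$-invariant, then $\mathrm{ext}(H)$ is also $f$-invariant.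
   Context: Graphs are directed graphs $E=(E^0,E^1,r,s)$, assumed row-finite ($s^{-1}(v)$ finite for all $v$). $K$ is a field. $L_K(E)$ is the Leavitt path algebra: the $K$-algebra generated by $E^0\cup E^1\cup\{e^*: e\in E^1\}$ with relations $vw=\delta_{v,w}v$, $s(e)e=e=e\,r(e)$, $r(e)e^*=e^*=e^*s(e)$, $e^*f=\delta_{e,f}r(e)$, and $v=\sum_{s(e)=v}ee^*$ for each regular vertex $v$ ($0<|s^{-1}(v)|<\infty$). $I(X)$ is the two-sided ideal of $L_K(E)$ generated by $X\subseteq E^0$. For an ideal $I$ of an algebra $A$, $\mathrm{Ann}(I)=\{a\in A: aI=Ia=0\}$. Write $u\ge v$ if there is a path (possibly of length $0$) from $u$ to $v$, and $u\ge X$ if $u\ge x$ for some $x\in X\subseteq E^0$. A set $X\subseteq E^0$ is hereditary if $v\in X$, $v\ge w$ imply $w\in X$; it is saturated if every regular vertex $v$ with $r(s^{-1}(v))\subseteq X$ lies in $X$. A point functor is a functor $H$ from the category of graphs (morphisms: graph isomorphisms) to sets such that $H(E)\subseteq E^0$ for every graph $E$ (a subfunctor of $E\mapsto E^0$). It is hereditary (saturated) if $H(E)$ is hereditary (saturated) for all $E$. The point functor $\mathrm{ext}(H)$ is $\mathrm{ext}(H)(E)=\{v\in E^0: v\not\ge H(E)\}$. For a ring isomorphism $f\colon L_K(E)\to L_K(F)$, $H_1$ is $f$-related to $H_2$ if $f(I(H_1(E)))=I(H_2(F))$; $H$ is $f$-invariant if it is $f$-related to itself. *)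

theory Defs
  imports
    "Graph_Theory.Digraph"
    "Graph_Theory.Arc_Walk"
    "Graph_Theory.Digraph_Isomorphism"
    "HOL-Algebra.QuotRing"
    "HOL-Algebra.Module"
    "HOL-Library.Poly_Mapping"
begin

section \<open>Row-finite graphs, hereditary and saturated sets\<close>

text \<open>In the notation $E=(E^0,E^1,r,s)$ the source map is \<^const>\<open>tail\<close>, the range map is
  \<^const>\<open>head\<close> and $s^{-1}(v)$ is \<^term>\<open>out_arcs E v\<close>. Graphs may be infinite.\<close>

locale row_finite_digraph = wf_digraph +
  assumes finite_out_arcs: "v \<in> verts G \<Longrightarrow> finite (out_arcs G v)"

definition regular_vertex :: "('v, 'e) pre_digraph \<Rightarrow> 'v \<Rightarrow> bool" where
  "regular_vertex E v \<longleftrightarrow> v \<in> verts E \<and> out_arcs E v \<noteq> {} \<and> finite (out_arcs E v)"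

definition path_geq :: "('v, 'e) pre_digraph \<Rightarrow> 'v \<Rightarrow> 'v \<Rightarrow> bool" where
  "path_geq E u v \<longleftrightarrow> (\<exists>p. pre_digraph.awalk E u p v)"

definition path_geq_set :: "('v, 'e) pre_digraph \<Rightarrow> 'v \<Rightarrow> 'v set \<Rightarrow> bool" where
  "path_geq_set E u X \<longleftrightarrow> (\<exists>x\<in>X. path_geq E u x)"

definition hereditary_set :: "('v, 'e) pre_digraph \<Rightarrow> 'v set \<Rightarrow> bool" where
  "hereditary_set E X \<longleftrightarrow> (\<forall>v w. v \<in> X \<and> path_geq E v w \<longrightarrow> w \<in> X)"

definition saturated_set :: "('v, 'e) pre_digraph \<Rightarrow> 'v set \<Rightarrow> bool" where
  "saturated_set E X \<longleftrightarrow> (\<forall>v. regular_vertex E v \<and> head E ` out_arcs E v \<subseteq> X \<longrightarrow> v \<in> X)"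


section \<open>Point functors\<close>

text \<open>A graph isomorphism from $E$ to $F$ is a pair of bijections on vertices and on arcs that
  commute with the source and range maps. In a \<^typ>\<open>('v, 'e, 'v, 'e) digraph_isomorphism\<close>
  the additional components \<open>iso_tail\<close> and \<open>iso_head\<close> merely name the source and range maps of
  the codomain; taking them to be those of $F$, every graph isomorphism from $E$ to $F$ arises
  in this way, whatever the values of the maps outside the arcs.\<close>

definition graph_iso ::
  "('v, 'e) pre_digraph \<Rightarrow> ('v, 'e) pre_digraph \<Rightarrow> ('v, 'e, 'v, 'e) digraph_isomorphism \<Rightarrow> bool"
  where "graph_iso E F h \<longleftrightarrow> pre_digraph.digraph_isomorphism E h \<and> F = app_iso h E"

text \<open>The category of graphs consists of the row-finite graphs with vertices in \<^typ>\<open>'v\<close> and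
  edges in \<^typ>\<open>'e\<close>; both types are arbitrary. A subfunctor of $E \mapsto E^0$ is determined by its
  action on objects, because a morphism acts by restriction of its vertex map.\<close>

type_synonym ('v, 'e) graph_points = "('v, 'e) pre_digraph \<Rightarrow> 'v set"

definition point_functor :: "('v, 'e) graph_points \<Rightarrow> bool" where
  "point_functor H \<longleftrightarrow>
     (\<forall>E. row_finite_digraph E \<longrightarrow> H E \<subseteq> verts E) \<and>
     (\<forall>E F h. row_finite_digraph E \<and> row_finite_digraph F \<and> graph_iso E F h
        \<longrightarrow> iso_verts h ` H E \<subseteq> H F)"

definition hereditary_functor :: "('v, 'e) graph_points \<Rightarrow> bool" where
  "hereditary_functor H \<longleftrightarrow> (\<forall>E. row_finite_digraph E \<longrightarrow> hereditary_set E (H E))"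

definition saturated_functor :: "('v, 'e) graph_points \<Rightarrow> bool" where
  "saturated_functor H \<longleftrightarrow> (\<forall>E. row_finite_digraph E \<longrightarrow> saturated_set E (H E))"

definition hersat_point_functor :: "('v, 'e) graph_points \<Rightarrow> bool" where
  "hersat_point_functor H \<longleftrightarrow> point_functor H \<and> hereditary_functor H \<and> saturated_functor H"

definition ext :: "('v, 'e) graph_points \<Rightarrow> ('v, 'e) graph_points" where
  "ext H E = {v \<in> verts E. \<not> path_geq_set E v (H E)}"


section \<open>Algebras without unit\<close>

text \<open>A Leavitt path algebra has a unit only if the graph has finitely many vertices. Algebras
  over a field \<^typ>\<open>'k\<close> are represented by \<^typ>\<open>('k, 'a) module\<close> records whose field \<open>one\<close>
  carries no meaning, and ideals, annihilators and isomorphisms do not refer to it.\<close>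

definition alg_ideal :: "('k, 'a, 'm) module_scheme \<Rightarrow> 'a set \<Rightarrow> bool" where
  "alg_ideal A I \<longleftrightarrow> I \<subseteq> carrier A \<and> \<zero>\<^bsub>A\<^esub> \<in> I \<and>
     (\<forall>x\<in>I. \<forall>y\<in>I. x \<oplus>\<^bsub>A\<^esub> y \<in> I) \<and>
     (\<forall>c. \<forall>x\<in>I. c \<odot>\<^bsub>A\<^esub> x \<in> I) \<and>
     (\<forall>a\<in>carrier A. \<forall>x\<in>I. a \<otimes>\<^bsub>A\<^esub> x \<in> I \<and> x \<otimes>\<^bsub>A\<^esub> a \<in> I)"

definition alg_genideal :: "('k, 'a, 'm) module_scheme \<Rightarrow> 'a set \<Rightarrow> 'a set" where
  "alg_genideal A S = \<Inter>{I. alg_ideal A I \<and> S \<subseteq> I}"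

definition quot_alg :: "('k, 'a, 'm) module_scheme \<Rightarrow> 'a set \<Rightarrow> ('k, 'a set) module" where
  "quot_alg A J = ring.extend (A Quot J)
     (module.fields (\<lambda>c Y. \<Union>y\<in>Y. J +>\<^bsub>A\<^esub> (c \<odot>\<^bsub>A\<^esub> y)))"

definition annihilator :: "('a, 'm) ring_scheme \<Rightarrow> 'a set \<Rightarrow> 'a set" where
  "annihilator A I =
     {a \<in> carrier A. \<forall>x\<in>I. a \<otimes>\<^bsub>A\<^esub> x = \<zero>\<^bsub>A\<^esub> \<and> x \<otimes>\<^bsub>A\<^esub> a = \<zero>\<^bsub>A\<^esub>}"

text \<open>Unlike \<^const>\<open>ring_iso\<close>, no condition on \<open>one\<close>.\<close>

definition rng_iso :: "('a, 'm) ring_scheme \<Rightarrow> ('b, 'n) ring_scheme \<Rightarrow> ('a \<Rightarrow> 'b) set" where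
  "rng_iso A B = iso (add_monoid A) (add_monoid B) \<inter> hom A B"


section \<open>Free algebras\<close>

datatype 'g free_word = Word (letters: "'g list")

instantiation free_word :: (type) monoid_add
begin

definition zero_free_word :: "'a free_word" where
  "0 = Word []"

definition plus_free_word :: "'a free_word \<Rightarrow> 'a free_word \<Rightarrow> 'a free_word" where
  "x + y = Word (letters x @ letters y)"

instance
  by standard (simp_all add: zero_free_word_def plus_free_word_def)

end

text \<open>With concatenation of words written additively, the product of \<^typ>\<open>'g free_word \<Rightarrow>\<^sub>0 'k\<close>
  is that of the algebra of words. Excluding the empty word gives the free algebra without unit
  on the generators \<open>X\<close>.\<close>

type_synonym ('g, 'k) free_elem = "'g free_word \<Rightarrow>\<^sub>0 'k"

definition free_alg :: "'g set \<Rightarrow> ('k::field, ('g, 'k) free_elem) module" where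
  "free_alg X =
     \<lparr>carrier = {p. Poly_Mapping.keys p \<subseteq> Word ` (lists X - {[]})},
      mult = (*), one = undefined, zero = 0, add = (+),
      smult = (\<lambda>c. Poly_Mapping.map ((*) c))\<rparr>"

definition free_gen :: "'g \<Rightarrow> ('g, 'k::field) free_elem" where
  "free_gen g = Poly_Mapping.single (Word [g]) 1"


section \<open>Leavitt path algebras\<close>

datatype ('v, 'e) leavitt_gen = Vertex 'v | Edge 'e | Ghost 'e

definition leavitt_gens :: "('v, 'e) pre_digraph \<Rightarrow> ('v, 'e) leavitt_gen set" where
  "leavitt_gens E = Vertex ` verts E \<union> Edge ` arcs E \<union> Ghost ` arcs E"

definition leavitt_relators ::
  "('v, 'e) pre_digraph \<Rightarrow> (('v, 'e) leavitt_gen, 'k::field) free_elem set" where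
  "leavitt_relators E =
     (let V = (\<lambda>v. free_gen (Vertex v)); R = (\<lambda>e. free_gen (Edge e)); G = (\<lambda>e. free_gen (Ghost e))
      in {V v * V w - (if v = w then V v else 0) | v w. v \<in> verts E \<and> w \<in> verts E} \<union>
         {V (tail E e) * R e - R e | e. e \<in> arcs E} \<union>
         {R e * V (head E e) - R e | e. e \<in> arcs E} \<union>
         {V (head E e) * G e - G e | e. e \<in> arcs E} \<union>
         {G e * V (tail E e) - G e | e. e \<in> arcs E} \<union>
         {G e * R f - (if e = f then V (head E e) else 0) | e f. e \<in> arcs E \<and> f \<in> arcs E} \<union>
         {V v - (\<Sum>e\<in>out_arcs E v. R e * G e) | v. regular_vertex E v})"

type_synonym ('v, 'e, 'k) leavitt_elem = "(('v, 'e) leavitt_gen, 'k) free_elem set"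

definition leavitt_kernel ::
  "('v, 'e) pre_digraph \<Rightarrow> (('v, 'e) leavitt_gen, 'k::field) free_elem set" where
  "leavitt_kernel E = alg_genideal (free_alg (leavitt_gens E)) (leavitt_relators E)"

definition leavitt ::
  "'k::field itself \<Rightarrow> ('v, 'e) pre_digraph \<Rightarrow> ('k, ('v, 'e, 'k) leavitt_elem) module" where
  "leavitt K E = quot_alg (free_alg (leavitt_gens E)) (leavitt_kernel E)"

definition leavitt_vertex :: "('v, 'e) pre_digraph \<Rightarrow> 'v \<Rightarrow> ('v, 'e, 'k::field) leavitt_elem" where
  "leavitt_vertex E v =
     leavitt_kernel E +>\<^bsub>(free_alg (leavitt_gens E) :: ('k, _) module)\<^esub> free_gen (Vertex v)"

text \<open>The ideal $I(X)$. As $L_K(E)$ has local units, it makes no difference whether ideals are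
  required to be closed under scalars.\<close>

definition vertex_ideal ::
  "'k::field itself \<Rightarrow> ('v, 'e) pre_digraph \<Rightarrow> 'v set \<Rightarrow> ('v, 'e, 'k) leavitt_elem set" where
  "vertex_ideal K E X = alg_genideal (leavitt K E) (leavitt_vertex E ` X)"

definition f_related ::
  "(('v, 'e, 'k::field) leavitt_elem \<Rightarrow> ('v, 'e, 'k) leavitt_elem) \<Rightarrow>
   ('v, 'e) pre_digraph \<Rightarrow> ('v, 'e) pre_digraph \<Rightarrow>
   ('v, 'e) graph_points \<Rightarrow> ('v, 'e) graph_points \<Rightarrow> bool" where
  "f_related f E F H1 H2 \<longleftrightarrow>
     f ` vertex_ideal TYPE('k) E (H1 E) = vertex_ideal TYPE('k) F (H2 F)"

definition f_invariant ::
  "(('v, 'e, 'k::field) leavitt_elem \<Rightarrow> ('v, 'e, 'k) leavitt_elem) \<Rightarrow>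
   ('v, 'e) pre_digraph \<Rightarrow> ('v, 'e) pre_digraph \<Rightarrow> ('v, 'e) graph_points \<Rightarrow> bool" where
  "f_invariant f E F H \<longleftrightarrow> f_related f E F H H"

end

(* The ideals I(H(E)) and I(ext(H)(E)) annihilate each other because no vertex is a descendant of
   both a vertex of ext(H)(E) and a vertex of H(E). Conversely let a I(H(E)) = 0. By the relation
   v = sum e e^*, a lies in an ideal I as soon as a q lies in I for all real paths q that are long
   or end in a sink. For such q all ghost edges in a q cancel, so that a q is a combination of real
   paths ending in r(q). Either r(q) is in ext(H)(E), or there is a path t from r(q) to H(E); then
   a q t = 0, and a q = 0 because real paths are linearly independent. *)

theory Submission
  imports Defs
begin

section \<open>Ideals and quotients of free algebras\<close>

text \<open>The quotient by the Leavitt relations has no unit in general, so the calculations use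
  representatives in the free algebra modulo \<open>leavitt_kernel\<close>; ideals of the quotient
  become ideals of the free algebra that contain this kernel.

  Why ghost edges cancel: the generators in a word of a act on q from the left one by one, and a
  ghost edge either strips the first edge of a path or gives 0. A q with enough edges outlasts all
  ghost edges of a; if a shorter q ends in a sink, a ghost edge that meets the bare sink gives 0.
  All surviving real paths keep the endpoint r(q), and this serves both inclusions. If u is in
  ext(H)(E) and q starts at w in H(E), a real path from u to r(q) would make r(q) a common
  descendant, so u a w q = 0. In the converse, all real paths in a q can be prolonged by the same t.

  Independence has to hold modulo the relations. It comes from a representation on boundary paths,
  where the coefficient of a real path p can be read off as a single value of a function; no basis
  of the whole algebra is involved.\<close>

lemma poly_mapping_sum_single:
  "a = (\<Sum>w\<in>Poly_Mapping.keys a. Poly_Mapping.single w (Poly_Mapping.lookup a w))"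
  by (rule poly_mapping_eqI)
    (auto simp: lookup_sum lookup_single when_def in_keys_iff sum.delta)

lemma map_scale_mult:
  fixes a b :: "('g, 'k::field) free_elem"
  shows "Poly_Mapping.map ((*) c) a * b = Poly_Mapping.map ((*) c) (a * b)"
    and "a * Poly_Mapping.map ((*) c) b = Poly_Mapping.map ((*) c) (a * b)"
proof -
  \<comment> \<open>Scaling by c is multiplication by c on the empty word, an element of the ambient
    unital algebra that is central because the field is commutative.\<close>
  have comm: "Poly_Mapping.single 0 c * x = x * Poly_Mapping.single 0 c" for x :: "('g, 'k) free_elem"
  proof -
    let ?s = "\<Sum>w\<in>Poly_Mapping.keys x. Poly_Mapping.single w (Poly_Mapping.lookup x w)"
    have "Poly_Mapping.single 0 c * ?s = ?s * Poly_Mapping.single 0 c"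
      by (simp add: sum_distrib_left sum_distrib_right mult_single mult.commute)
    then show ?thesis
      by (simp only: poly_mapping_sum_single[symmetric])
  qed
  show "Poly_Mapping.map ((*) c) a * b = Poly_Mapping.map ((*) c) (a * b)"
    by (simp add: mult_map_scale_conv_mult mult.assoc)
  show "a * Poly_Mapping.map ((*) c) b = Poly_Mapping.map ((*) c) (a * b)"
    by (simp add: mult_map_scale_conv_mult mult.assoc[symmetric] comm[of a])
qed

lemma map_scale_minus_one: "Poly_Mapping.map ((*) (- 1)) a = - (a :: ('g, 'k::field) free_elem)"
  by (simp add: mult_map_scale_conv_mult single_uminus)

lemma map_scale_diff:
  "Poly_Mapping.map ((*) c) a - Poly_Mapping.map ((*) c) b
    = Poly_Mapping.map ((*) c) (a - b :: ('g, 'k::field) free_elem)"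
  by (simp add: mult_map_scale_conv_mult right_diff_distrib)

lemma keys_map_scale:
  "Poly_Mapping.keys (Poly_Mapping.map ((*) c) (a :: ('g, 'k::field) free_elem)) \<subseteq> Poly_Mapping.keys a"
  by (auto simp: mult_map_scale_conv_mult dest!: subsetD[OF keys_mult] split: if_splits)

lemma free_alg_simps [simp]:
  "mult (free_alg X) = (*)" "zero (free_alg X) = 0" "add (free_alg X) = (+)"
  "smult (free_alg X) = (\<lambda>c. Poly_Mapping.map ((*) c))"
  by (simp_all add: free_alg_def)

lemma carrier_free_alg:
  "carrier (free_alg X) = {p. Poly_Mapping.keys p \<subseteq> Word ` (lists X - {[]})}"
  by (simp add: free_alg_def)

lemma alg_ideal_carrier: "alg_ideal (free_alg X) (carrier (free_alg X :: ('k::field, _) module))"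
proof -
  have plus: "v + w \<in> Word ` (lists X - {[]})"
    if v: "v \<in> Word ` (lists X - {[]})" and w: "w \<in> Word ` (lists X - {[]})" for v w :: "'a free_word"
  proof -
    from v w obtain x y where "v = Word x" "w = Word y" "x \<in> lists X - {[]}" "y \<in> lists X - {[]}"
      by blast
    then have "v + w = Word (x @ y)" "x @ y \<in> lists X - {[]}"
      by (simp_all add: plus_free_word_def)
    then show ?thesis
      by blast
  qed
  have mult: "a * b \<in> carrier (free_alg X)"
    if "a \<in> carrier (free_alg X)" "b \<in> carrier (free_alg X)" for a b :: "('a, 'k) free_elem"
    unfolding carrier_free_alg
  proof (intro CollectI subsetI)
    fix w assume "w \<in> Poly_Mapping.keys (a * b)"
    then obtain u v where "w = u + v" "u \<in> Poly_Mapping.keys a" "v \<in> Poly_Mapping.keys b"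
      using keys_mult[of a b] by blast
    then show "w \<in> Word ` (lists X - {[]})"
      using that plus[of u v] by (simp only: carrier_free_alg mem_Collect_eq subset_iff)
  qed
  have add: "a + b \<in> carrier (free_alg X)"
    if "a \<in> carrier (free_alg X)" "b \<in> carrier (free_alg X)" for a b :: "('a, 'k) free_elem"
    using that unfolding carrier_free_alg mem_Collect_eq
    by (intro subset_trans[OF keys_add Un_least])
  have scale: "Poly_Mapping.map ((*) c) a \<in> carrier (free_alg X)"
    if "a \<in> carrier (free_alg X)" for c and a :: "('a, 'k) free_elem"
    using that unfolding carrier_free_alg mem_Collect_eq
    by (intro subset_trans[OF keys_map_scale])
  have zero: "(0 :: ('a, 'k) free_elem) \<in> carrier (free_alg X)"
    by (simp add: carrier_free_alg)
  show ?thesis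
    unfolding alg_ideal_def free_alg_simps
    by (intro conjI ballI allI subset_refl zero add scale mult)
qed

lemma free_gen_in_carrier: "g \<in> X \<Longrightarrow> free_gen g \<in> carrier (free_alg X)"
  by (auto simp: carrier_free_alg free_gen_def)

text \<open>The empty word gives no case, as it is excluded from the carrier. The scalar enters with
  the last letter of a word and the other letters are put in front, which suits statements about
  multiplication by a from the left.\<close>

lemma free_alg_induct [consumes 1, case_names zero add gen mult]:
  fixes a :: "('g, 'k::field) free_elem"
  assumes a: "a \<in> carrier (free_alg X)"
    and zero: "P 0"
    and add: "\<And>a b. P a \<Longrightarrow> P b \<Longrightarrow> P (a + b)"
    and gen: "\<And>c g. g \<in> X \<Longrightarrow> P (Poly_Mapping.map ((*) c) (free_gen g))"
    and mult: "\<And>g a. g \<in> X \<Longrightarrow> a \<in> carrier (free_alg X) \<Longrightarrow> P a \<Longrightarrow> P (free_gen g * a)"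
  shows "P a"
proof -
  have word: "P (Poly_Mapping.single (Word w) c)" if "w \<in> lists X" "w \<noteq> []" for w c
    using that
  proof (induction w)
    case (Cons g w)
    show ?case
    proof (cases "w = []")
      case True
      then show ?thesis
        using gen[OF Cons.hyps(1), of c] by (simp add: free_gen_def)
    next
      case False
      have "Poly_Mapping.single (Word w) c \<in> carrier (free_alg X)"
        using Cons.hyps(2) False by (auto simp: carrier_free_alg)
      then have "P (free_gen g * Poly_Mapping.single (Word w) c)"
        using Cons False by (intro mult) auto
      then show ?thesis
        by (simp add: free_gen_def mult_single plus_free_word_def)
    qed
  qed simp
  have "P (\<Sum>w\<in>A. Poly_Mapping.single w (Poly_Mapping.lookup a w))"
    if "A \<subseteq> Poly_Mapping.keys a" for A
    using finite_subset[OF that finite_keys] that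
  proof (induction A)
    case (insert w A)
    then have "w \<in> Word ` (lists X - {[]})"
      using a by (auto simp: carrier_free_alg)
    then have "P (Poly_Mapping.single w (Poly_Mapping.lookup a w))"
      by (auto intro: word)
    with insert show ?case
      by (simp add: add)
  qed (simp add: zero)
  from this[OF subset_refl] show ?thesis
    by (simp only: poly_mapping_sum_single[symmetric])
qed

lemma alg_genideal_superset: "S \<subseteq> alg_genideal A S"
  by (auto simp: alg_genideal_def)

lemma alg_genideal_minimal: "alg_ideal A I \<Longrightarrow> S \<subseteq> I \<Longrightarrow> alg_genideal A S \<subseteq> I"
  by (auto simp: alg_genideal_def)

lemma alg_ideal_genideal:
  assumes "alg_ideal A (carrier A)" "S \<subseteq> carrier A"
  shows "alg_ideal A (alg_genideal A S)"
  unfolding alg_ideal_def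
proof (intro conjI ballI allI)
  show "alg_genideal A S \<subseteq> carrier A"
    using assms by (rule alg_genideal_minimal)
qed (auto simp: alg_genideal_def alg_ideal_def)

section \<open>Quotients of free algebras, calculated on representatives\<close>

locale free_alg_quotient =
  fixes X :: "'g set" and J :: "('g, 'k::field) free_elem set"
  assumes ideal: "alg_ideal (free_alg X) J"
begin

abbreviation C :: "('g, 'k) free_elem set" where "C \<equiv> carrier (free_alg X)"
abbreviation Q :: "('k, ('g, 'k) free_elem set) module" where "Q \<equiv> quot_alg (free_alg X) J"
abbreviation coset :: "('g, 'k) free_elem \<Rightarrow> ('g, 'k) free_elem set" where
  "coset a \<equiv> J +>\<^bsub>(free_alg X :: ('k, _) module)\<^esub> a"

lemma ideal_uminus: "- a \<in> I" if "alg_ideal (free_alg X) I" "a \<in> I" for a :: "('g, 'k) free_elem"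
proof -
  have "Poly_Mapping.map ((*) (- 1)) a \<in> I"
    using that by (simp add: alg_ideal_def)
  then show ?thesis
    by (simp only: map_scale_minus_one)
qed

lemma ideal_diff: "a - b \<in> I"
  if "alg_ideal (free_alg X) I" "a \<in> I" "b \<in> I" for a b :: "('g, 'k) free_elem"
proof -
  have "a + (- b) \<in> I"
    using that(1,2) ideal_uminus[OF that(1,3)] unfolding alg_ideal_def free_alg_simps by blast
  then show ?thesis by simp
qed

lemma ideal_closed:
  assumes "alg_ideal (free_alg X) (I :: ('g, 'k) free_elem set)"
  shows "I \<subseteq> C" "0 \<in> I" "a \<in> I \<Longrightarrow> b \<in> I \<Longrightarrow> a + b \<in> I"
    "a \<in> I \<Longrightarrow> Poly_Mapping.map ((*) c) a \<in> I"
    "a \<in> C \<Longrightarrow> b \<in> I \<Longrightarrow> a * b \<in> I" "a \<in> I \<Longrightarrow> b \<in> C \<Longrightarrow> a * b \<in> I"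
    "a \<in> I \<Longrightarrow> - a \<in> I" "a \<in> I \<Longrightarrow> b \<in> I \<Longrightarrow> a - b \<in> I"
  using assms ideal_uminus[OF assms] ideal_diff[OF assms]
  unfolding alg_ideal_def free_alg_simps by blast+

lemmas C_closed [simp, intro] = ideal_closed(2-5,7,8)[OF alg_ideal_carrier]
lemmas J_closed = ideal_closed[OF ideal]

lemma coset_conv: "coset a = (\<lambda>j. j + a) ` J"
  by (auto simp: a_r_coset_def r_coset_def)

lemma mem_coset_iff: "b \<in> coset a \<longleftrightarrow> b - a \<in> J"
proof
  assume "b - a \<in> J"
  then have "(b - a) + a \<in> coset a"
    unfolding coset_conv by (rule imageI)
  then show "b \<in> coset a"
    by simp
qed (auto simp: coset_conv)

lemma coset_eq_iff: "coset a = coset b \<longleftrightarrow> a - b \<in> J"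
proof
  show "coset a = coset b \<Longrightarrow> a - b \<in> J"
    using mem_coset_iff[of a a] mem_coset_iff[of a b] J_closed(2) by simp
next
  assume ab: "a - b \<in> J"
  have "x - a \<in> J \<longleftrightarrow> x - b \<in> J" for x
    using J_closed(3)[OF _ ab, of "x - a"] J_closed(8)[OF _ ab, of "x - b"] by auto
  then show "coset a = coset b"
    by (auto simp: mem_coset_iff)
qed

lemma coset_carrier [simp]: "carrier Q = coset ` C"
  by (auto simp: quot_alg_def ring.extend_def module.fields_def FactRing_def A_RCOSETS_def RCOSETS_def a_r_coset_def)

lemma coset_zero: "zero Q = coset 0"
  by (simp add: quot_alg_def ring.extend_def module.fields_def FactRing_def coset_conv)

lemma coset_add: "add Q (coset a) (coset b) = coset (a + b)"
proof -
  have "add Q (coset a) (coset b) = {x + y | x y. x - a \<in> J \<and> y - b \<in> J}"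
    by (auto simp: quot_alg_def ring.extend_def module.fields_def FactRing_def set_add_def set_mult_def
        mem_coset_iff Bex_def) blast
  also have "\<dots> = coset (a + b)"
  proof (intro equalityI subsetI)
    fix z assume "z \<in> {x + y | x y. x - a \<in> J \<and> y - b \<in> J}"
    then obtain x y where z: "z = x + y" and "x - a \<in> J" "y - b \<in> J"
      by blast
    then have "(x - a) + (y - b) \<in> J"
      by (blast intro: J_closed(3))
    also have "(x - a) + (y - b) = z - (a + b)"
      by (simp add: z)
    finally show "z \<in> coset (a + b)"
      by (simp only: mem_coset_iff)
  next
    fix z assume "z \<in> coset (a + b)"
    then have "z - b - a \<in> J"
      by (simp add: mem_coset_iff diff_diff_eq add.commute)
    moreover have "z = (z - b) + b" "b - b \<in> J"
      using J_closed(2) by simp_all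
    ultimately show "z \<in> {x + y | x y. x - a \<in> J \<and> y - b \<in> J}"
      by blast
  qed
  finally show ?thesis .
qed

lemma J_mult_cong:
  assumes "a - a' \<in> J" "b - b' \<in> J" "a' \<in> C" "b \<in> C"
  shows "a * b - a' * b' \<in> J"
proof -
  have "a * b - a' * b' = (a - a') * b + a' * (b - b')"
    by (simp add: algebra_simps)
  then show ?thesis
    using assms by (simp add: J_closed)
qed

lemma sum_C: "(\<And>i. i \<in> A \<Longrightarrow> f i \<in> C) \<Longrightarrow> sum f A \<in> C"
  by (induction A rule: infinite_finite_induct) auto

lemma sum_ideal:
  "alg_ideal (free_alg X) I \<Longrightarrow> (\<And>i. i \<in> A \<Longrightarrow> f i \<in> I) \<Longrightarrow> sum f A \<in> (I :: ('g, 'k) free_elem set)"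
  by (induction A rule: infinite_finite_induct) (auto intro: ideal_closed)

lemma mem_C_if_coset: "a \<in> C \<Longrightarrow> x - a \<in> J \<Longrightarrow> x \<in> C"
  using C_closed(2)[of "x - a" a] subsetD[OF J_closed(1)] by simp

lemma coset_mult:
  assumes "a \<in> C" "b \<in> C"
  shows "mult Q (coset a) (coset b) = coset (a * b)"
proof -
  have "mult Q (coset a) (coset b) = (\<Union>x\<in>coset a. \<Union>y\<in>coset b. coset (x * y))"
    by (simp add: quot_alg_def ring.extend_def module.fields_def FactRing_def rcoset_mult_def)
  \<comment> \<open>The product of cosets is a union over all representatives: its members coincide
    by \<open>J_mult_cong\<close>, and the index sets are nonempty since a and b lie in their own
    cosets.\<close>
  also have "\<dots> = (\<Union>x\<in>coset a. \<Union>y\<in>coset b. coset (a * b))"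
    using assms mem_C_if_coset
    by (intro SUP_cong refl) (auto simp: mem_coset_iff coset_eq_iff intro!: J_mult_cong)
  also have "\<dots> = coset (a * b)"
    using J_closed(2) mem_coset_iff[of a a] mem_coset_iff[of b b] by auto
  finally show ?thesis .
qed

lemma coset_smult: "smult Q c (coset a) = coset (Poly_Mapping.map ((*) c) a)"
proof -
  have "smult Q c (coset a) = (\<Union>y\<in>coset a. coset (Poly_Mapping.map ((*) c) y))"
    by (simp add: quot_alg_def ring.extend_def module.fields_def)
  also have "\<dots> = (\<Union>y\<in>coset a. coset (Poly_Mapping.map ((*) c) a))"
    by (intro SUP_cong refl) (auto simp: mem_coset_iff coset_eq_iff map_scale_diff J_closed)
  also have "\<dots> = coset (Poly_Mapping.map ((*) c) a)"
    using J_closed(2) mem_coset_iff[of a a] by auto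
  finally show ?thesis .
qed

section \<open>Transfer of ideals and annihilators between free algebra and quotient\<close>

lemma alg_ideal_coset_image:
  assumes "alg_ideal (free_alg X) I"
  shows "alg_ideal Q (coset ` I)"
proof -
  have "I \<subseteq> C" using assms by (simp add: alg_ideal_def)
  then show ?thesis
    using assms unfolding alg_ideal_def
    by (auto simp: coset_zero coset_add coset_mult coset_smult subset_iff)
qed

lemma alg_ideal_coset_vimage:
  assumes "alg_ideal Q I"
  shows "alg_ideal (free_alg X) {a \<in> C. coset a \<in> I}"
  using assms unfolding alg_ideal_def
  by (auto simp: coset_zero coset_add[symmetric] coset_mult[symmetric] coset_smult[symmetric])

lemma J_subset_coset_vimage:
  assumes "alg_ideal Q I"
  shows "J \<subseteq> {a \<in> C. coset a \<in> I}"
proof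
  fix x assume "x \<in> J"
  then have "coset x = zero Q" "x \<in> C"
    using J_closed(1) by (auto simp: coset_zero coset_eq_iff)
  then show "x \<in> {a \<in> C. coset a \<in> I}"
    using assms by (simp add: alg_ideal_def)
qed

lemma alg_ideal_quot_carrier: "alg_ideal Q (carrier Q)"
  using alg_ideal_coset_image[OF alg_ideal_carrier] by simp

lemma annihilator_conv:
  assumes "I \<subseteq> carrier Q"
  shows "annihilator Q I = coset ` {a \<in> C. \<forall>x\<in>{x \<in> C. coset x \<in> I}. a * x \<in> J \<and> x * a \<in> J}"
proof -
  let ?P = "{x \<in> C. coset x \<in> I}"
  have I: "I = coset ` ?P"
    using assms by auto
  have zero: "coset a = zero Q \<longleftrightarrow> a \<in> J" for a
    by (simp add: coset_zero coset_eq_iff)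
  have "(\<forall>y\<in>I. mult Q (coset a) y = zero Q \<and> mult Q y (coset a) = zero Q) \<longleftrightarrow>
      (\<forall>x\<in>?P. a * x \<in> J \<and> x * a \<in> J)" if "a \<in> C" for a
    by (subst I) (simp add: coset_mult zero that)
  then show ?thesis
    unfolding annihilator_def by auto
qed

text \<open>Needed because a generated ideal lies in the annihilator by minimality once its
  generators do. For products: (b a) x = b (a x) and x (b a) = (x b) a, where x b is again in the
  preimage of the ideal.\<close>

lemma alg_ideal_annihilator:
  assumes "alg_ideal Q I"
  shows "alg_ideal Q (annihilator Q I)"
proof -
  let ?P = "{x \<in> C. coset x \<in> I}"
  let ?N = "{a \<in> C. \<forall>x\<in>?P. a * x \<in> J \<and> x * a \<in> J}"
  have P: "a * x \<in> ?P" "x * a \<in> ?P" if "a \<in> C" "x \<in> ?P" for a x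
    using alg_ideal_coset_vimage[OF assms] that unfolding alg_ideal_def by auto
  have mult: "b * a \<in> ?N \<and> a * b \<in> ?N" if "b \<in> C" "a \<in> ?N" for a b
  proof -
    have "b * a * x \<in> J \<and> x * (b * a) \<in> J \<and> a * b * x \<in> J \<and> x * (a * b) \<in> J" if "x \<in> ?P" for x
    proof (intro conjI)
      show "b * a * x \<in> J" "x * (a * b) \<in> J"
        using \<open>a \<in> ?N\<close> \<open>b \<in> C\<close> that J_closed(5)[of b "a * x"] J_closed(6)[of "x * a" b]
        by (auto simp: mult.assoc)
      show "x * (b * a) \<in> J" "a * b * x \<in> J"
        using \<open>a \<in> ?N\<close> P(1)[OF \<open>b \<in> C\<close> that] P(2)[OF \<open>b \<in> C\<close> that]
        by (auto simp: mult.assoc)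
    qed
    then show ?thesis
      using that by blast
  qed
  have "alg_ideal (free_alg X) ?N"
    unfolding alg_ideal_def
  proof (intro conjI ballI allI)
    show "a \<otimes>\<^bsub>free_alg X\<^esub> x \<in> ?N" "x \<otimes>\<^bsub>free_alg X\<^esub> a \<in> ?N" if "a \<in> C" "x \<in> ?N" for a x
      using mult[OF that] by simp_all
  qed (auto simp: J_closed distrib_left distrib_right map_scale_mult)
  from alg_ideal_coset_image[OF this] show ?thesis
    using assms by (subst annihilator_conv) (auto simp: alg_ideal_def)
qed

end

section \<open>Real paths in Leavitt path algebras\<close>

text \<open>\<open>K\<close> fixes the type of scalars, which the graph does not mention.\<close>

locale leavitt_graph = row_finite_digraph G
  for G :: "('v, 'e) pre_digraph" +
  fixes K :: "'k::field itself"
begin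

abbreviation J :: "(('v, 'e) leavitt_gen, 'k) free_elem set" where "J \<equiv> leavitt_kernel G"
abbreviation vtx :: "'v \<Rightarrow> (('v, 'e) leavitt_gen, 'k) free_elem" where "vtx v \<equiv> free_gen (Vertex v)"
abbreviation edg :: "'e \<Rightarrow> (('v, 'e) leavitt_gen, 'k) free_elem" where "edg e \<equiv> free_gen (Edge e)"
abbreviation gho :: "'e \<Rightarrow> (('v, 'e) leavitt_gen, 'k) free_elem" where "gho e \<equiv> free_gen (Ghost e)"

lemma gens_in_carrier:
  "v \<in> verts G \<Longrightarrow> vtx v \<in> carrier (free_alg (leavitt_gens G))"
  "e \<in> arcs G \<Longrightarrow> edg e \<in> carrier (free_alg (leavitt_gens G))"
  "e \<in> arcs G \<Longrightarrow> gho e \<in> carrier (free_alg (leavitt_gens G))"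
  by (auto intro!: free_gen_in_carrier simp: leavitt_gens_def)

lemma relators_in_carrier:
  "leavitt_relators G \<subseteq> (carrier (free_alg (leavitt_gens G)) :: (('v, 'e) leavitt_gen, 'k) free_elem set)"
proof -
  \<comment> \<open>The closure rules for the carrier belong to a locale about an ideal. Taking the
    whole carrier as that ideal supplies them before the kernel is known to be one.\<close>
  interpret whole: free_alg_quotient "leavitt_gens G"
    "carrier (free_alg (leavitt_gens G)) :: (('v, 'e) leavitt_gen, 'k) free_elem set"
    by unfold_locales (rule alg_ideal_carrier)
  show ?thesis
    by (auto simp: leavitt_relators_def Let_def gens_in_carrier regular_vertex_def
        intro!: whole.sum_C whole.C_closed)
qed

sublocale free_alg_quotient "leavitt_gens G" J
  by unfold_locales (simp add: leavitt_kernel_def alg_ideal_genideal alg_ideal_carrier relators_in_carrier)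

lemmas gens_in_C [simp, intro] = gens_in_carrier

section \<open>Calculation modulo the Leavitt relations\<close>

definition cong :: "(('v, 'e) leavitt_gen, 'k) free_elem \<Rightarrow> (('v, 'e) leavitt_gen, 'k) free_elem \<Rightarrow> bool"
    (infix "\<approx>" 50) where
  "a \<approx> b \<longleftrightarrow> a - b \<in> J"

lemma cong_refl [simp]: "a \<approx> a"
  by (simp add: cong_def J_closed)

lemma cong_sym: "a \<approx> b \<Longrightarrow> b \<approx> a"
  using J_closed(7)[of "a - b"] by (simp add: cong_def)

lemma cong_add: "a \<approx> b \<Longrightarrow> c \<approx> d \<Longrightarrow> a + c \<approx> b + d"
  using J_closed(3)[of "a - b" "c - d"] by (simp add: cong_def algebra_simps)

lemma cong_trans [trans]: "a \<approx> b \<Longrightarrow> b \<approx> c \<Longrightarrow> a \<approx> c"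
  using J_closed(3)[of "a - b" "b - c"] by (simp add: cong_def)

lemma cong_mult_left: "a \<approx> b \<Longrightarrow> c \<in> C \<Longrightarrow> c * a \<approx> c * b"
  using J_closed(5)[of c "a - b"] by (simp add: cong_def right_diff_distrib)

lemma cong_mult_right: "a \<approx> b \<Longrightarrow> c \<in> C \<Longrightarrow> a * c \<approx> b * c"
  using J_closed(6)[of "a - b" c] by (simp add: cong_def left_diff_distrib)

lemma cong_scale: "a \<approx> b \<Longrightarrow> Poly_Mapping.map ((*) c) a \<approx> Poly_Mapping.map ((*) c) b"
  using J_closed(4)[of "a - b" c] by (simp add: cong_def map_scale_diff)

lemma cong_sum: "(\<And>i. i \<in> A \<Longrightarrow> f i \<approx> g i) \<Longrightarrow> sum f A \<approx> sum g A"
  by (induction A rule: infinite_finite_induct) (auto intro: cong_add)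

lemma cong_zero_iff: "a \<approx> 0 \<longleftrightarrow> a \<in> J"
  by (simp add: cong_def)

lemma cong_mem_ideal:
  assumes "alg_ideal (free_alg (leavitt_gens G)) I" "J \<subseteq> I" "a \<approx> b" "b \<in> I"
  shows "a \<in> I"
proof -
  have "(a - b) + b \<in> I"
    using assms(2-) by (intro ideal_closed(3)[OF assms(1)]) (auto simp: cong_def)
  then show ?thesis by simp
qed

lemma relator_in_J: "r \<in> leavitt_relators G \<Longrightarrow> r \<in> J"
  unfolding leavitt_kernel_def by (rule subsetD[OF alg_genideal_superset])

lemma leavitt_relations:
  "v \<in> verts G \<Longrightarrow> w \<in> verts G \<Longrightarrow> vtx v * vtx w \<approx> (if v = w then vtx v else 0)"
  "e \<in> arcs G \<Longrightarrow> vtx (tail G e) * edg e \<approx> edg e"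
  "e \<in> arcs G \<Longrightarrow> edg e * vtx (head G e) \<approx> edg e"
  "e \<in> arcs G \<Longrightarrow> vtx (head G e) * gho e \<approx> gho e"
  "e \<in> arcs G \<Longrightarrow> gho e * vtx (tail G e) \<approx> gho e"
  "e \<in> arcs G \<Longrightarrow> f \<in> arcs G \<Longrightarrow> gho e * edg f \<approx> (if e = f then vtx (head G e) else 0)"
  "regular_vertex G v \<Longrightarrow> vtx v \<approx> (\<Sum>e\<in>out_arcs G v. edg e * gho e)"
  unfolding cong_def by (rule relator_in_J, unfold leavitt_relators_def Let_def, blast)+

text \<open>The closing vertex gives a path of length 0 a nonempty word and makes the endpoint part
  of the monomial, so that a word determines its path, including the one of length 0.\<close>

definition path_elem :: "'e list \<Rightarrow> 'v \<Rightarrow> (('v, 'e) leavitt_gen, 'k) free_elem" where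
  "path_elem p v = Poly_Mapping.single (Word (map Edge p @ [Vertex v])) 1"

lemma path_elem_simps:
  "path_elem [] v = vtx v" "path_elem (e # p) v = edg e * path_elem p v"
  by (simp_all add: path_elem_def free_gen_def mult_single plus_free_word_def)

lemma path_elem_in_C: "set p \<subseteq> arcs G \<Longrightarrow> v \<in> verts G \<Longrightarrow> path_elem p v \<in> C"
  by (induction p) (auto simp: path_elem_simps)

lemma awalk_path_elem_in_C [simp, intro]: "awalk u p v \<Longrightarrow> path_elem p v \<in> C"
  by (auto intro!: path_elem_in_C)

lemma vtx_edg:
  assumes "v \<in> verts G" "e \<in> arcs G"
  shows "vtx v * edg e \<approx> (if v = tail G e then edg e else 0)"
proof -
  have "vtx v * edg e \<approx> vtx v * (vtx (tail G e) * edg e)"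
    using assms by (intro cong_mult_left cong_sym[OF leavitt_relations(2)]) auto
  also have "\<dots> = (vtx v * vtx (tail G e)) * edg e"
    by (simp add: mult.assoc)
  also have "\<dots> \<approx> (if v = tail G e then vtx v else 0) * edg e"
    using assms by (intro cong_mult_right leavitt_relations) auto
  finally show ?thesis
    using assms leavitt_relations(2)[of e] by (auto elim: cong_trans split: if_splits)
qed

lemma gho_vtx:
  assumes "v \<in> verts G" "e \<in> arcs G"
  shows "gho e * vtx v \<approx> (if v = tail G e then gho e else 0)"
proof -
  have "gho e * vtx v \<approx> (gho e * vtx (tail G e)) * vtx v"
    using assms by (intro cong_mult_right cong_sym[OF leavitt_relations(5)]) auto
  also have "\<dots> = gho e * (vtx (tail G e) * vtx v)"
    by (simp add: mult.assoc)
  also have "\<dots> \<approx> gho e * (if tail G e = v then vtx (tail G e) else 0)"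
    using assms by (intro cong_mult_left leavitt_relations) auto
  finally show ?thesis
    using assms leavitt_relations(5)[of e] by (auto elim: cong_trans split: if_splits)
qed

lemma edg_vtx:
  assumes "v \<in> verts G" "e \<in> arcs G"
  shows "edg e * vtx v \<approx> (if v = head G e then edg e else 0)"
proof -
  have "edg e * vtx v \<approx> (edg e * vtx (head G e)) * vtx v"
    using assms by (intro cong_mult_right cong_sym[OF leavitt_relations(3)]) auto
  also have "\<dots> = edg e * (vtx (head G e) * vtx v)"
    by (simp add: mult.assoc)
  also have "\<dots> \<approx> edg e * (if head G e = v then vtx (head G e) else 0)"
    using assms by (intro cong_mult_left leavitt_relations) auto
  finally show ?thesis
    using assms leavitt_relations(3)[of e] by (auto elim: cong_trans split: if_splits)
qed

lemma vtx_path_elem: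
  assumes "awalk u p v" "w \<in> verts G"
  shows "vtx w * path_elem p v \<approx> (if w = u then path_elem p v else 0)"
proof (cases p)
  case Nil
  then have "u = v" "v \<in> verts G"
    using assms by (auto simp: awalk_Nil_iff)
  then show ?thesis
    using assms leavitt_relations(1)[of w v] Nil by (cases "w = v") (simp_all add: path_elem_simps)
next
  case (Cons e q)
  then have e: "e \<in> arcs G" "u = tail G e" "awalk (head G e) q v"
    using assms by (auto simp: awalk_Cons_iff)
  have "vtx w * path_elem p v = (vtx w * edg e) * path_elem q v"
    by (simp add: Cons path_elem_simps mult.assoc)
  also have "\<dots> \<approx> (if w = tail G e then edg e else 0) * path_elem q v"
    using e assms by (intro cong_mult_right vtx_edg) auto
  finally show ?thesis
    by (simp add: Cons e path_elem_simps split: if_splits)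
qed

lemma gho_path_elem_Cons:
  assumes "awalk u (f # p) v" "e \<in> arcs G"
  shows "gho e * path_elem (f # p) v \<approx> (if e = f then path_elem p v else 0)"
proof -
  have f: "f \<in> arcs G" "u = tail G f" "awalk (head G f) p v"
    using assms by (auto simp: awalk_Cons_iff)
  have "gho e * path_elem (f # p) v = (gho e * edg f) * path_elem p v"
    by (simp add: path_elem_simps mult.assoc)
  also have "\<dots> \<approx> (if e = f then vtx (head G e) else 0) * path_elem p v"
    using f assms by (intro cong_mult_right leavitt_relations) auto
  finally show ?thesis
    using vtx_path_elem[OF f(3), of "head G f"] f by (auto elim: cong_trans split: if_splits)
qed

lemma path_elem_vtx:
  assumes "awalk u p v"
  shows "path_elem p v * vtx v \<approx> path_elem p v"
  using assms
proof (induction p arbitrary: u)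
  case Nil
  then have "v \<in> verts G"
    by (auto simp: awalk_Nil_iff)
  then show ?case
    using leavitt_relations(1)[of v v] by (simp add: path_elem_simps)
next
  case (Cons e p)
  then have "e \<in> arcs G" "path_elem p v * vtx v \<approx> path_elem p v"
    by (auto simp: awalk_Cons_iff)
  then show ?case
    using cong_mult_left[of "path_elem p v * vtx v" "path_elem p v" "edg e"]
    by (simp add: path_elem_simps mult.assoc)
qed

lemma path_elem_edg:
  assumes "awalk u p (tail G e)" "e \<in> arcs G"
  shows "path_elem p (tail G e) * edg e \<approx> path_elem (p @ [e]) (head G e)"
  using assms(1)
proof (induction p arbitrary: u)
  case Nil
  have "vtx (tail G e) * edg e \<approx> edg e" "edg e \<approx> edg e * vtx (head G e)"
    using assms by (auto intro: leavitt_relations cong_sym)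
  then show ?case
    by (auto simp: path_elem_simps elim: cong_trans)
next
  case (Cons f p)
  then have "f \<in> arcs G" "path_elem p (tail G e) * edg e \<approx> path_elem (p @ [e]) (head G e)"
    by (auto simp: awalk_Cons_iff)
  then show ?case
    using cong_mult_left[of "path_elem p (tail G e) * edg e" "path_elem (p @ [e]) (head G e)" "edg f"]
    by (simp add: path_elem_simps mult.assoc)
qed

lemma path_elem_mem_ideal:
  assumes I: "alg_ideal (free_alg (leavitt_gens G)) I" "J \<subseteq> I" and "vtx v \<in> I" "awalk u p v"
  shows "path_elem p v \<in> I"
proof (rule cong_mem_ideal[OF I])
  show "path_elem p v \<approx> path_elem p v * vtx v"
    using assms(4) by (intro cong_sym[OF path_elem_vtx])
  show "path_elem p v * vtx v \<in> I"
    using assms by (intro ideal_closed(5)[OF I(1)]) auto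
qed


section \<open>Reduction to long real paths\<close>

text \<open>Replaces the missing unit by a finite sum of vertices. The claim about all larger finite
  sets carries the case of a sum, where the union of two sets has to serve both summands.\<close>

lemma right_local_unit:
  assumes "a \<in> C"
  shows "\<exists>W. finite W \<and> W \<subseteq> verts G \<and>
    (\<forall>W'. finite W' \<and> W \<subseteq> W' \<and> W' \<subseteq> verts G \<longrightarrow> a * (\<Sum>v\<in>W'. vtx v) \<approx> a)"
  using assms
proof (induction a rule: free_alg_induct)
  case zero
  show ?case by (intro exI[of _ "{}"]) simp
next
  case (add a b)
  from add(1) obtain A where A: "finite A" "A \<subseteq> verts G"
    and a: "\<forall>W'. finite W' \<and> A \<subseteq> W' \<and> W' \<subseteq> verts G \<longrightarrow> a * (\<Sum>v\<in>W'. vtx v) \<approx> a"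
    by (elim exE conjE)
  from add(2) obtain B where B: "finite B" "B \<subseteq> verts G"
    and b: "\<forall>W'. finite W' \<and> B \<subseteq> W' \<and> W' \<subseteq> verts G \<longrightarrow> b * (\<Sum>v\<in>W'. vtx v) \<approx> b"
    by (elim exE conjE)
  have "(a + b) * (\<Sum>v\<in>W. vtx v) \<approx> a + b" if "finite W" "A \<union> B \<subseteq> W" "W \<subseteq> verts G" for W
    unfolding distrib_right using that by (intro cong_add a[rule_format] b[rule_format]) auto
  then show ?case
    using A B by (intro exI[of _ "A \<union> B"]) simp
next
  case (gen c g)
  \<comment> \<open>w is the right end of the generator: a vertex itself, the head of an edge, and
    the tail for a ghost edge, which runs backwards.\<close>
  obtain w where w: "w \<in> verts G"
    "\<And>v. v \<in> verts G \<Longrightarrow> free_gen g * vtx v \<approx> (if v = w then free_gen g else 0)"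
  proof -
    consider v where "g = Vertex v" "v \<in> verts G" | e where "g = Edge e" "e \<in> arcs G"
      | e where "g = Ghost e" "e \<in> arcs G"
      using gen by (auto simp: leavitt_gens_def)
    then show thesis
    proof cases
      case (1 v)
      have "free_gen g * vtx w \<approx> (if w = v then free_gen g else 0)" if "w \<in> verts G" for w
        using leavitt_relations(1)[OF 1(2) that] 1(1) by (cases "w = v") simp_all
      then show ?thesis
        using 1(2) by (rule that[rotated])
    next
      case (2 e)
      then show ?thesis
        using edg_vtx[OF _ 2(2)] by (intro that[of "head G e"]) (simp_all only: head_in_verts)
    next
      case (3 e)
      then show ?thesis
        using gho_vtx[OF _ 3(2)] by (intro that[of "tail G e"]) (simp_all only: tail_in_verts)
    qed
  qed
  have "Poly_Mapping.map ((*) c) (free_gen g) * (\<Sum>v\<in>W. vtx v) \<approx> Poly_Mapping.map ((*) c) (free_gen g)"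
    if W: "finite W" "w \<in> W" "W \<subseteq> verts G" for W
  proof -
    have "free_gen g * (\<Sum>v\<in>W. vtx v) \<approx> (\<Sum>v\<in>W. if v = w then free_gen g else 0)"
      unfolding sum_distrib_left using W by (intro cong_sum w(2)) auto
    also have "\<dots> = free_gen g"
      using W by (simp add: sum.delta')
    finally show ?thesis
      by (simp add: map_scale_mult cong_scale)
  qed
  then show ?case
    using w(1) by (intro exI[of _ "{w}"]) simp
next
  case (mult g a)
  from mult.IH obtain W where W: "finite W" "W \<subseteq> verts G"
    "\<forall>W'. finite W' \<and> W \<subseteq> W' \<and> W' \<subseteq> verts G \<longrightarrow> a * (\<Sum>v\<in>W'. vtx v) \<approx> a"
    by (elim exE conjE)
  have "free_gen g * a * (\<Sum>v\<in>W'. vtx v) \<approx> free_gen g * a"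
    if "finite W'" "W \<subseteq> W'" "W' \<subseteq> verts G" for W'
    unfolding mult.assoc using that mult.hyps(1) by (intro cong_mult_left W(3)[rule_format] free_gen_in_carrier) simp_all
  then show ?case
    using W(1,2) by (intro exI[of _ W]) simp
qed

text \<open>By the last Leavitt relation, membership of \<open>a q\<close> in an ideal can be tested on the
  one-edge prolongations of \<open>q\<close>, as long as \<open>q\<close> does not end in a sink.\<close>

lemma mem_ideal_if_long_paths:
  assumes I: "alg_ideal (free_alg (leavitt_gens G)) I" "J \<subseteq> I" and a: "a \<in> C"
    and long: "\<And>u q v. awalk u q v \<Longrightarrow> N \<le> length q \<or> out_arcs G v = {} \<Longrightarrow> a * path_elem q v \<in> I"
  shows "a \<in> I"
proof -
  \<comment> \<open>n bounds the number of edges by which q may fall short of N. The empty paths are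
    reached with n = N.\<close>
  have paths: "a * path_elem q v \<in> I" if "awalk u q v" "N \<le> length q + n" for u q v n
    using that
  proof (induction n arbitrary: u q v)
    case (Suc n)
    show ?case
    proof (cases "out_arcs G v = {}")
      case False
      have v: "v \<in> verts G"
        using Suc.prems by auto
      \<comment> \<open>Row-finiteness enters here: every vertex that is not a sink is regular, so
        the relation for v as a sum over its outgoing edges is available.\<close>
      then have reg: "regular_vertex G v"
        using False finite_out_arcs by (auto simp: regular_vertex_def)
      have "a * path_elem q v * edg e * gho e \<in> I" if "e \<in> out_arcs G v" for e
      proof -
        from that have e: "e \<in> arcs G" "v = tail G e"
          by auto
        then have "awalk u (q @ [e]) (head G e)"
          using awalk_appendI[OF Suc.prems(1)] arc_implies_awalk[of e] by simp
        then have "a * path_elem (q @ [e]) (head G e) \<in> I"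
          using Suc.prems by (intro Suc.IH) auto
        moreover have "a * (path_elem q v * edg e) \<approx> a * path_elem (q @ [e]) (head G e)"
          using path_elem_edg[of u q e] Suc.prems e a by (auto intro: cong_mult_left)
        ultimately have "a * path_elem q v * edg e \<in> I"
          unfolding mult.assoc by (blast intro: cong_mem_ideal[OF I])
        then show ?thesis
          by (rule ideal_closed(6)[OF I(1)]) (use e in auto)
      qed
      then have "(\<Sum>e\<in>out_arcs G v. a * path_elem q v * edg e * gho e) \<in> I"
        by (intro sum_ideal[OF I(1)])
      then have "a * path_elem q v * (\<Sum>e\<in>out_arcs G v. edg e * gho e) \<in> I"
        by (simp add: sum_distrib_left mult.assoc)
      moreover have "a * path_elem q v * vtx v \<approx> a * path_elem q v * (\<Sum>e\<in>out_arcs G v. edg e * gho e)"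
        using reg a Suc.prems(1) by (intro cong_mult_left leavitt_relations) auto
      ultimately have "a * path_elem q v * vtx v \<in> I"
        by (blast intro: cong_mem_ideal[OF I])
      moreover have "a * path_elem q v \<approx> a * (path_elem q v * vtx v)"
        using Suc.prems(1) a by (intro cong_mult_left cong_sym[OF path_elem_vtx])
      ultimately show ?thesis
        unfolding mult.assoc by (blast intro: cong_mem_ideal[OF I])
    qed (use Suc.prems in \<open>auto intro: long\<close>)
  qed (auto intro: long)
  have vtx: "a * vtx v \<in> I" if "v \<in> verts G" for v
    using paths[of v "[]" v N] that by (simp add: awalk_Nil_iff path_elem_simps)
  obtain W where W: "W \<subseteq> verts G" "a * (\<Sum>v\<in>W. vtx v) \<approx> a"
    using right_local_unit[OF a] by (elim exE conjE) simp
  have "a * (\<Sum>v\<in>W. vtx v) \<in> I"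
    unfolding sum_distrib_left using W(1) by (intro sum_ideal[OF I(1)] vtx) auto
  then show ?thesis
    by (rule cong_mem_ideal[OF I cong_sym[OF W(2)]])
qed

section \<open>Combinations of long real paths under multiplication from the left\<close>

definition spanned :: "('v, 'e) leavitt_gen free_word set \<Rightarrow> (('v, 'e) leavitt_gen, 'k) free_elem set" where
  "spanned S = {a. \<exists>b. Poly_Mapping.keys b \<subseteq> S \<and> a \<approx> b}"

text \<open>The endpoint v is fixed and the start is free, as multiplication from the left changes
  only the start. A path into a sink counts as long at any length, since it cannot be
  prolonged.\<close>

definition long_paths :: "nat \<Rightarrow> 'v \<Rightarrow> ('v, 'e) leavitt_gen free_word set" where
  "long_paths k v = {Word (map Edge p @ [Vertex v]) | u p.
     awalk u p v \<and> (k \<le> length p \<or> out_arcs G v = {})}"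

lemma long_paths_antimono: "k \<le> l \<Longrightarrow> long_paths l v \<subseteq> long_paths k v"
  unfolding long_paths_def by (auto dest: le_trans)

lemma spanned_mono: "S \<subseteq> T \<Longrightarrow> spanned S \<subseteq> spanned T"
  unfolding spanned_def by blast

lemma spanned_empty: "spanned {} = J"
proof -
  have "Poly_Mapping.keys b \<subseteq> {} \<longleftrightarrow> b = 0" for b :: "(('v, 'e) leavitt_gen, 'k) free_elem"
    using keys_eq_empty[of b] by auto
  then show ?thesis
    unfolding spanned_def by (simp add: cong_zero_iff)
qed

lemma spanned_zero: "0 \<in> spanned S"
  unfolding spanned_def by (auto intro!: exI[of _ 0])

lemma spanned_add: "a \<in> spanned S \<Longrightarrow> b \<in> spanned S \<Longrightarrow> a + b \<in> spanned S"
proof -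
  assume "a \<in> spanned S" "b \<in> spanned S"
  then obtain x y where "Poly_Mapping.keys x \<subseteq> S" "a \<approx> x" "Poly_Mapping.keys y \<subseteq> S" "b \<approx> y"
    by (auto simp: spanned_def)
  then have "Poly_Mapping.keys (x + y) \<subseteq> S" "a + b \<approx> x + y"
    by (auto intro: cong_add dest!: subsetD[OF keys_add])
  then show ?thesis
    unfolding spanned_def by blast
qed

lemma spanned_scale: "a \<in> spanned S \<Longrightarrow> Poly_Mapping.map ((*) c) a \<in> spanned S"
proof -
  assume "a \<in> spanned S"
  then obtain x where "Poly_Mapping.keys x \<subseteq> S" "a \<approx> x"
    by (auto simp: spanned_def)
  then have "Poly_Mapping.keys (Poly_Mapping.map ((*) c) x) \<subseteq> S"
    "Poly_Mapping.map ((*) c) a \<approx> Poly_Mapping.map ((*) c) x"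
    by (auto intro: cong_scale dest!: subsetD[OF keys_map_scale])
  then show ?thesis
    unfolding spanned_def by blast
qed

lemma spanned_cong: "a \<approx> b \<Longrightarrow> b \<in> spanned S \<Longrightarrow> a \<in> spanned S"
  unfolding spanned_def by (blast intro: cong_trans)

lemma spanned_sum: "(\<And>i. i \<in> A \<Longrightarrow> f i \<in> spanned S) \<Longrightarrow> sum f A \<in> spanned S"
  by (induction A rule: infinite_finite_induct) (auto intro: spanned_add spanned_zero)

lemma path_elem_spanned:
  "awalk u p v \<Longrightarrow> k \<le> length p \<or> out_arcs G v = {} \<Longrightarrow> path_elem p v \<in> spanned (long_paths k v)"
proof -
  assume "awalk u p v" "k \<le> length p \<or> out_arcs G v = {}"
  then have "Word (map Edge p @ [Vertex v]) \<in> long_paths k v"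
    unfolding long_paths_def by blast
  then show ?thesis
    by (auto simp: spanned_def path_elem_def intro!: exI[of _ "path_elem p v"])
qed

lemma mult_spanned:
  assumes g: "g \<in> C" and a: "a \<in> spanned S"
    and S: "\<And>w. w \<in> S \<Longrightarrow> g * Poly_Mapping.single w 1 \<in> spanned T"
  shows "g * a \<in> spanned T"
proof -
  obtain b where b: "Poly_Mapping.keys b \<subseteq> S" "a \<approx> b"
    using a by (auto simp: spanned_def)
  have "g * Poly_Mapping.single w c \<in> spanned T" if "w \<in> S" for w c
    using spanned_scale[OF S[OF that], of c] by (simp flip: map_scale_mult(2))
  then have "g * (\<Sum>w\<in>Poly_Mapping.keys b. Poly_Mapping.single w (Poly_Mapping.lookup b w)) \<in> spanned T"
    using b(1) unfolding sum_distrib_left by (intro spanned_sum) auto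
  then have "g * b \<in> spanned T"
    by (simp only: poly_mapping_sum_single[symmetric])
  then show ?thesis
    using b(2) g by (blast intro: spanned_cong cong_mult_left)
qed

text \<open>A ghost edge strips at most the first edge, which costs one unit of length; vertices and
  edges never shorten a path.\<close>

lemma gen_mult_long_path:
  assumes "g \<in> leavitt_gens G" "w \<in> long_paths (Suc k) v"
  shows "free_gen g * Poly_Mapping.single w 1 \<in> spanned (long_paths k v)"
proof -
  obtain u p where w: "Poly_Mapping.single w 1 = path_elem p v" and p: "awalk u p v"
    "Suc k \<le> length p \<or> out_arcs G v = {}"
    using assms(2) by (auto simp: long_paths_def path_elem_def)
  then have base: "path_elem p v \<in> spanned (long_paths k v)"
    by (intro path_elem_spanned) auto
  consider x where "g = Vertex x" "x \<in> verts G" | e where "g = Edge e" "e \<in> arcs G"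
    | e where "g = Ghost e" "e \<in> arcs G"
    using assms(1) by (auto simp: leavitt_gens_def)
  then show ?thesis
  proof cases
    case (1 x)
    then show ?thesis
      using spanned_cong[OF vtx_path_elem[OF p(1)]] base by (auto simp: w spanned_zero)
  next
    case (2 e)
    have "edg e * path_elem p v \<approx> (edg e * vtx (head G e)) * path_elem p v"
      using 2 p by (intro cong_mult_right cong_sym[OF leavitt_relations(3)]) auto
    also have "\<dots> = edg e * (vtx (head G e) * path_elem p v)"
      by (simp add: mult.assoc)
    also have "\<dots> \<approx> edg e * (if head G e = u then path_elem p v else 0)"
      using 2 p by (intro cong_mult_left vtx_path_elem) auto
    also have "\<dots> = (if head G e = u then path_elem (e # p) v else 0)"
      by (simp add: path_elem_simps)
    finally have cong: "edg e * path_elem p v \<approx> (if head G e = u then path_elem (e # p) v else 0)" .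
    have "path_elem (e # p) v \<in> spanned (long_paths k v)" if "head G e = u"
      using 2 p that by (intro path_elem_spanned[of "tail G e"]) (auto simp: awalk_Cons_iff)
    then show ?thesis
      using spanned_cong[OF cong] 2 by (auto simp: w spanned_zero)
  next
    case (3 e)
    show ?thesis
    proof (cases p)
      \<comment> \<open>The length 0 is below \<open>Suc k\<close>, so v is a sink and cannot be the
        tail of e.\<close>
      case Nil
      then have "v \<in> verts G" "v \<noteq> tail G e"
        using p 3 by (auto simp: awalk_Nil_iff)
      then have "gho e * vtx v \<approx> 0"
        using gho_vtx[of v e] 3 by simp
      then show ?thesis
        using 3 Nil by (auto simp: w path_elem_simps intro: spanned_cong spanned_zero)
    next
      case (Cons f q)
      have "path_elem q v \<in> spanned (long_paths k v)"
        using p Cons by (intro path_elem_spanned[of "head G f"]) (auto simp: awalk_Cons_iff)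
      then show ?thesis
        using gho_path_elem_Cons[of u f q v e] p 3 Cons
        by (auto simp: w intro: spanned_cong spanned_zero split: if_splits)
    qed
  qed
qed

text \<open>N can be k plus the length of the longest word in a, whatever the endpoint v. The
  induction needs arbitrary k: a generator put in front of a requires \<open>Suc k\<close> from
  a.\<close>

lemma mult_long_paths:
  assumes "a \<in> C"
  shows "\<exists>N. \<forall>v. \<forall>b\<in>spanned (long_paths N v). a * b \<in> spanned (long_paths k v)"
  using assms
proof (induction a arbitrary: k rule: free_alg_induct)
  case zero
  show ?case by (simp add: spanned_zero)
next
  case (add a b)
  then obtain M N where "\<forall>v. \<forall>x\<in>spanned (long_paths M v). a * x \<in> spanned (long_paths k v)"
    "\<forall>v. \<forall>x\<in>spanned (long_paths N v). b * x \<in> spanned (long_paths k v)"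
    by metis
  moreover have "spanned (long_paths (max M N) v) \<subseteq> spanned (long_paths M v) \<inter> spanned (long_paths N v)" for v
    by (intro Int_greatest spanned_mono long_paths_antimono) simp_all
  ultimately show ?case
    unfolding distrib_right by (intro exI[of _ "max M N"]) (blast intro: spanned_add)
next
  case (gen c g)
  then show ?case
    by (intro exI[of _ "Suc k"])
      (auto simp: map_scale_mult intro!: spanned_scale mult_spanned gen_mult_long_path free_gen_in_carrier)
next
  case (mult g a)
  obtain N where "\<forall>v. \<forall>x\<in>spanned (long_paths N v). a * x \<in> spanned (long_paths (Suc k) v)"
    using mult.IH by blast
  then show ?case
    using mult.hyps(1)
    by (intro exI[of _ N]) (auto simp: mult.assoc intro!: mult_spanned[OF _ _ gen_mult_long_path] free_gen_in_carrier)
qed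

text \<open>Multiplying by long real paths turns \<open>u a w\<close> into a combination of real paths from \<open>u\<close> to
  descendants of \<open>w\<close>.\<close>

lemma vtx_mult_vtx_in_kernel:
  assumes a: "a \<in> C" and u: "u \<in> verts G" and w: "w \<in> verts G"
    and disj: "\<And>r. path_geq G u r \<Longrightarrow> \<not> path_geq G w r"
  shows "vtx u * a * vtx w \<in> J"
proof -
  obtain N where N: "\<And>v b. b \<in> spanned (long_paths N v) \<Longrightarrow> a * b \<in> spanned (long_paths 0 v)"
    using mult_long_paths[OF a] by blast
  show ?thesis
  \<comment> \<open>The reduction is applied with the kernel itself as the ideal. The bound N for a
    suffices, because w q is either q or 0 modulo the relations.\<close>
  proof (rule mem_ideal_if_long_paths[OF ideal subset_refl, of _ N])
    show "vtx u * a * vtx w \<in> C"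
      using a u w by auto
  next
    fix x q v assume q: "awalk x q v" "N \<le> length q \<or> out_arcs G v = {}"
    have "vtx u * a * (vtx w * path_elem q v) \<approx> vtx u * a * (if w = x then path_elem q v else 0)"
      using a u w q by (intro cong_mult_left vtx_path_elem) auto
    moreover have "vtx u * (a * path_elem q v) \<in> J" if "w = x"
    proof -
      have "a * path_elem q v \<in> spanned (long_paths 0 v)"
        using q by (intro N path_elem_spanned)
      moreover have "vtx u * Poly_Mapping.single s 1 \<in> spanned {}" if s: "s \<in> long_paths 0 v" for s
      proof -
        obtain y p where p: "awalk y p v" "Poly_Mapping.single s 1 = path_elem p v"
          using s by (auto simp: long_paths_def path_elem_def)
        \<comment> \<open>Otherwise v would be reached from u by p and from w by q. So every
          monomial is killed by u, which is expressed as membership in \<open>spanned {}\<close>,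
          that is, in J.\<close>
        have "u \<noteq> y"
          using disj[of v] p q \<open>w = x\<close> by (auto simp: path_geq_def)
        then show ?thesis
          using vtx_path_elem[OF p(1) u] p(2) by (simp add: spanned_empty cong_zero_iff)
      qed
      ultimately show ?thesis
        using mult_spanned[of "vtx u" "a * path_elem q v" "long_paths 0 v" "{}"] u
        by (simp add: spanned_empty)
    qed
    ultimately show "vtx u * a * vtx w * path_elem q v \<in> J"
      by (cases "w = x") (auto simp: mult.assoc J_closed(2) intro: cong_mem_ideal[OF ideal subset_refl])
  qed
qed

end

section \<open>Linear independence of real paths\<close>

text \<open>Covers all elements of the type, including the empty word, because \<open>act\<close>
  below is defined and multiplicative on all of them.\<close>

lemma free_elem_induct [case_names single add]:
  fixes a :: "('g, 'k::field) free_elem"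
  assumes single: "\<And>w c. P (Poly_Mapping.single w c)"
    and add: "\<And>a b. P a \<Longrightarrow> P b \<Longrightarrow> P (a + b)"
  shows "P a"
proof -
  have "P (\<Sum>w\<in>A. Poly_Mapping.single w (Poly_Mapping.lookup a w))" if "finite A" for A
    using that by induction (use single[of 0 0] in \<open>auto intro: add single\<close>)
  from this[OF finite_keys[of a]] show ?thesis
    by (simp only: poly_mapping_sum_single[symmetric])
qed

context leavitt_graph
begin

text \<open>The algebra acts on functions of a boundary path (an infinite path, or a path ending in a
  sink, padded with \<^const>\<open>None\<close>) and an integer. The integer records lengths: without it, the
  powers of a cycle without exits would act in the same way.\<close>

coinductive boundary_path :: "'v \<Rightarrow> (nat \<Rightarrow> 'e option) \<Rightarrow> bool" where
  sink: "v \<in> verts G \<Longrightarrow> out_arcs G v = {} \<Longrightarrow> boundary_path v (\<lambda>_. None)"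
| edge: "e \<in> arcs G \<Longrightarrow> boundary_path (head G e) s \<Longrightarrow> boundary_path (tail G e) (case_nat (Some e) s)"

lemma boundary_path_NoneD: "boundary_path v s \<Longrightarrow> s 0 = None \<Longrightarrow> out_arcs G v = {}"
  by (erule boundary_path.cases) auto

lemma boundary_path_SomeD:
  "boundary_path v s \<Longrightarrow> s 0 = Some e \<Longrightarrow>
    e \<in> arcs G \<and> v = tail G e \<and> boundary_path (head G e) (\<lambda>i. s (Suc i))"
  by (erule boundary_path.cases) auto

lemma boundary_path_exists:
  assumes "v \<in> verts G"
  shows "\<exists>s. boundary_path v s"
proof -
  define nxt where "nxt v = (SOME e. e \<in> out_arcs G v)" for v
  \<comment> \<open>One outgoing edge is chosen at each vertex and followed forever. At a sink the
    walk stays put, which produces the padding with \<open>None\<close>.\<close>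
  define step where "step v = (if out_arcs G v = {} then v else head G (nxt v))" for v
  define path where
    "path v = (\<lambda>n. let u = (step ^^ n) v in if out_arcs G u = {} then None else Some (nxt u))" for v
  have nxt: "nxt u \<in> out_arcs G u" if "out_arcs G u \<noteq> {}" for u
    using that unfolding nxt_def by (rule some_in_eq[THEN iffD2])
  have "boundary_path v s" if "v \<in> verts G \<and> s = path v" for v s
    using that
  proof (coinduction arbitrary: v s)
    case (boundary_path v s)
    show ?case
    proof (cases "out_arcs G v = {}")
      case True
      then have "(step ^^ n) v = v" for n
        by (induction n) (simp_all add: step_def)
      then have "path v = (\<lambda>_. None)"
        using True by (simp add: path_def Let_def)
      then show ?thesis
        using True boundary_path by auto
    next
      case False
      then have "path v n = case_nat (Some (nxt v)) (path (head G (nxt v))) n" for n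
        by (cases n) (simp_all add: path_def step_def funpow_Suc_right del: funpow.simps(2))
      then have "path v = case_nat (Some (nxt v)) (path (head G (nxt v)))" ..
      moreover have "nxt v \<in> arcs G" "tail G (nxt v) = v"
        using nxt[OF False] by auto
      ultimately show ?thesis
        using boundary_path by (intro disjI2 exI[of _ "nxt v"] exI[of _ "path (head G (nxt v))"]) simp
    qed
  qed
  then show ?thesis
    using assms by blast
qed

text \<open>In terms of point masses, an edge e sends the one at (r(e), s, n) to the one at (s(e),
  es, n + 1), and its ghost reverses this; on functions the arguments move the opposite way, hence n
  - 1 for an edge. The vertex stays in the triple because the empty boundary path looks the same at
  every sink. The tests for \<open>boundary_path\<close> discard triples on which the vertex
  relation at a regular vertex would fail.\<close>

primrec gen_act :: "('v, 'e) leavitt_gen \<Rightarrow> ('v \<times> (nat \<Rightarrow> 'e option) \<times> int \<Rightarrow> 'k)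
    \<Rightarrow> 'v \<times> (nat \<Rightarrow> 'e option) \<times> int \<Rightarrow> 'k" where
  "gen_act (Vertex v) f = (\<lambda>(u, s, n). if u = v \<and> boundary_path u s then f (u, s, n) else 0)"
| "gen_act (Edge e) f = (\<lambda>(u, s, n).
     if u = tail G e \<and> boundary_path u s \<and> s 0 = Some e then f (head G e, \<lambda>i. s (Suc i), n - 1) else 0)"
| "gen_act (Ghost e) f = (\<lambda>(u, s, n).
     if u = head G e \<and> boundary_path u s then f (tail G e, case_nat (Some e) s, n + 1) else 0)"

definition word_act where "word_act w f = foldr gen_act (letters w) f"

definition act where
  "act a f x = (\<Sum>w\<in>Poly_Mapping.keys a. Poly_Mapping.lookup a w * word_act w f x)"

lemma gen_act_linear:
  "gen_act g (\<lambda>x. f x + h x) = (\<lambda>x. gen_act g f x + gen_act g h x)"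
  "gen_act g (\<lambda>x. c * f x) = (\<lambda>x. c * gen_act g f x)"
  by (cases g; auto simp: fun_eq_iff)+

lemma word_act_linear:
  "word_act w (\<lambda>x. f x + h x) = (\<lambda>x. word_act w f x + word_act w h x)"
  "word_act w (\<lambda>x. c * f x) = (\<lambda>x. c * word_act w f x)"
proof -
  have "foldr gen_act gs (\<lambda>x. f x + h x) = (\<lambda>x. foldr gen_act gs f x + foldr gen_act gs h x)"
    "foldr gen_act gs (\<lambda>x. c * f x) = (\<lambda>x. c * foldr gen_act gs f x)" for gs
    by (induction gs) (simp_all add: gen_act_linear)
  then show "word_act w (\<lambda>x. f x + h x) = (\<lambda>x. word_act w f x + word_act w h x)"
    "word_act w (\<lambda>x. c * f x) = (\<lambda>x. c * word_act w f x)"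
    by (simp_all add: word_act_def)
qed

lemma act_single: "act (Poly_Mapping.single w c) f = (\<lambda>x. c * word_act w f x)"
  by (auto simp: act_def fun_eq_iff)

lemma act_add: "act (a + b) f = (\<lambda>x. act a f x + act b f x)"
proof
  fix x
  show "act (a + b) f x = act a f x + act b f x"
    unfolding act_def
    by (rule setsum_keys_plus_distrib[of "\<lambda>w c. c * word_act w f x"]) (simp_all add: distrib_right)
qed

lemma act_zero [simp]: "act 0 f = (\<lambda>_. 0)"
  by (simp add: act_def fun_eq_iff)

lemma act_diff: "act (a - b) f = (\<lambda>x. act a f x - act b f x)"
  using act_add[of "a - b" b f] by (simp add: fun_eq_iff)

lemma act_sum: "act (sum a A) f x = (\<Sum>i\<in>A. act (a i) f x)"
  by (induction A rule: infinite_finite_induct) (simp_all add: act_add)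

lemma act_linear:
  "act a (\<lambda>x. f x + h x) = (\<lambda>x. act a f x + act a h x)"
  "act a (\<lambda>_. 0) = (\<lambda>_. 0)"
proof -
  have "word_act w (\<lambda>_. 0) = (\<lambda>_. 0)" for w
    using word_act_linear(2)[of w 0 "\<lambda>_. 0"] by simp
  then show "act a (\<lambda>_. 0) = (\<lambda>_. 0)"
    by (simp add: act_def fun_eq_iff)
qed (simp add: act_def fun_eq_iff word_act_linear sum.distrib distrib_left)

lemma act_mult: "act (a * b) f = act a (act b f)"
proof (induction a rule: free_elem_induct)
  case (single w c)
  show ?case
  proof (induction b rule: free_elem_induct)
    case (single u d)
    have "word_act (w + u) f = word_act w (word_act u f)"
      by (simp add: word_act_def plus_free_word_def)
    then show ?case
      by (simp add: mult_single act_single word_act_linear mult.assoc)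
  qed (simp add: distrib_left act_add act_linear)
qed (simp add: distrib_right act_add)

lemma act_scale: "act (Poly_Mapping.map ((*) c) a) f = (\<lambda>x. c * act a f x)"
  by (simp add: mult_map_scale_conv_mult act_mult act_single word_act_def zero_free_word_def)

lemma act_gen: "act (free_gen g) f = gen_act g f"
  by (simp add: free_gen_def act_single word_act_def)

lemma act_relator:
  assumes "r \<in> leavitt_relators G"
  shows "act r f x = 0"
proof -
  obtain u s n where x: "x = (u, s, n)"
    by (cases x)
  \<comment> \<open>A boundary path from a regular vertex is not empty, so exactly one summand
    survives, the one of its first edge. At all other triples both sides are 0.\<close>
  have ck2: "(if u = v \<and> boundary_path u s then f (u, s, n) else 0) =
      (\<Sum>e\<in>out_arcs G v. gen_act (Edge e) (gen_act (Ghost e) f) (u, s, n))"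
    if v: "regular_vertex G v" for v
  proof (cases "u = v \<and> boundary_path u s")
    case True
    then obtain e where e: "s 0 = Some e"
      using boundary_path_NoneD[of u s] v by (cases "s 0") (auto simp: regular_vertex_def)
    then have e': "e \<in> arcs G" "u = tail G e" "boundary_path (head G e) (\<lambda>i. s (Suc i))"
      using True boundary_path_SomeD by auto
    have "case_nat (Some e) (\<lambda>i. s (Suc i)) = s"
      using e by (auto simp: fun_eq_iff split: nat.split)
    then have "gen_act (Edge d) (gen_act (Ghost d) f) (u, s, n) = (if d = e then f (u, s, n) else 0)" for d
      using True e e' by auto
    then have "(\<Sum>d\<in>out_arcs G v. gen_act (Edge d) (gen_act (Ghost d) f) (u, s, n)) =
        (\<Sum>d\<in>out_arcs G v. if d = e then f (u, s, n) else 0)"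
      by (intro sum.cong refl)
    also have "\<dots> = f (u, s, n)"
      using True v e' by (simp add: regular_vertex_def)
    finally show ?thesis
      using True by (auto simp del: gen_act.simps)
  next
    case False
    then have "gen_act (Edge d) (gen_act (Ghost d) f) (u, s, n) = 0" if "d \<in> out_arcs G v" for d
      using that by auto
    then have "(\<Sum>d\<in>out_arcs G v. gen_act (Edge d) (gen_act (Ghost d) f) (u, s, n)) = 0"
      by (intro sum.neutral ballI)
    then show ?thesis
      using False by (auto simp del: gen_act.simps)
  qed
  note act_simps = act_diff act_mult act_gen act_sum x
  show ?thesis
    using assms unfolding leavitt_relators_def Let_def Un_iff mem_Collect_eq
  proof (elim disjE exE conjE)
    fix v w assume "r = vtx v * vtx w - (if v = w then vtx v else 0)"
    then show ?thesis by (auto simp: act_simps)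
  next
    fix e assume "r = vtx (tail G e) * edg e - edg e"
    then show ?thesis by (auto simp: act_simps)
  next
    fix e assume r: "r = edg e * vtx (head G e) - edg e"
    have "boundary_path (head G e) (\<lambda>i. s (Suc i))" if "boundary_path u s" "s 0 = Some e"
      using boundary_path_SomeD[OF that] by simp
    then show ?thesis by (auto simp: r act_simps)
  next
    fix e assume "r = vtx (head G e) * gho e - gho e"
    then show ?thesis by (auto simp: act_simps)
  next
    fix e assume r: "r = gho e * vtx (tail G e) - gho e" and e: "e \<in> arcs G"
    have "boundary_path (tail G e) (case_nat (Some e) s)" if "boundary_path (head G e) s"
      using e that by (rule boundary_path.edge)
    then show ?thesis by (auto simp: r act_simps)
  next
    fix d e assume r: "r = gho d * edg e - (if d = e then vtx (head G d) else 0)" and d: "d \<in> arcs G"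
    have "boundary_path (tail G d) (case_nat (Some d) s)" if "boundary_path (head G d) s"
      using d that by (rule boundary_path.edge)
    then show ?thesis by (auto simp: r act_simps)
  next
    fix v assume "r = vtx v - (\<Sum>e\<in>out_arcs G v. edg e * gho e)" "regular_vertex G v"
    then show ?thesis
      using ck2[of v] by (simp add: act_simps del: gen_act.simps(2,3))
  qed
qed

lemma act_kernel:
  assumes "a \<in> J"
  shows "act a f = (\<lambda>_. 0)"
proof -
  \<comment> \<open>Quantifying over f inside the set makes it closed under multiplication from the
    right, where a meets the function \<open>act b f\<close>.\<close>
  let ?I = "{a \<in> C. \<forall>f. act a f = (\<lambda>_. 0)}"
  have "alg_ideal (free_alg (leavitt_gens G)) ?I"
    unfolding alg_ideal_def free_alg_simps
    by (auto simp: act_add act_mult act_linear act_scale)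
  moreover have "leavitt_relators G \<subseteq> ?I"
    using subsetD[OF relators_in_carrier] act_relator by (intro subsetI CollectI conjI allI HOL.ext)
  ultimately have "J \<subseteq> ?I"
    unfolding leavitt_kernel_def by (rule alg_genideal_minimal)
  then show ?thesis
    using assms by auto
qed

section \<open>Action of real paths on point masses\<close>

definition prepend :: "'e list \<Rightarrow> (nat \<Rightarrow> 'e option) \<Rightarrow> nat \<Rightarrow> 'e option" where
  "prepend p s = foldr (\<lambda>e. case_nat (Some e)) p s"

text \<open>The lengths must be known to agree: for a cycle c and s = ccc..., prepending any power
  of c gives s again. The integer coordinate will supply this agreement.\<close>

lemma prepend_inject:
  assumes "prepend p s = prepend q s" "length p = length q"
  shows "p = q"
  using assms(2,1)
proof (induction p q rule: list_induct2)
  case (Cons d p e q)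
  then have eq: "case_nat (Some d) (prepend p s) = case_nat (Some e) (prepend q s)"
    by (simp add: prepend_def)
  from fun_cong[OF eq, of 0] fun_cong[OF eq, of "Suc _"] Cons.IH show ?case
    by (simp add: fun_eq_iff)
qed simp

lemma boundary_path_prepend:
  "awalk u p v \<Longrightarrow> boundary_path v s \<Longrightarrow> boundary_path u (prepend p s)"
  by (induction p arbitrary: u) (auto simp: prepend_def awalk_Nil_iff awalk_Cons_iff intro: boundary_path.edge)

lemma path_act:
  assumes "awalk u p v" "boundary_path v s"
  shows "word_act (Word (map Edge p @ [Vertex v])) (\<lambda>x. if x = (v, s, n) then 1 else 0)
    = (\<lambda>x. if x = (u, prepend p s, n + int (length p)) then 1 else 0)"
  using assms(1)
proof (induction p arbitrary: u)
  case Nil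
  then show ?case
    using assms(2) by (auto simp: word_act_def prepend_def awalk_Nil_iff)
next
  case (Cons e p)
  then have e: "e \<in> arcs G" "u = tail G e" "awalk (head G e) p v"
    by (auto simp: awalk_Cons_iff)
  have bp: "boundary_path (tail G e) (case_nat (Some e) (prepend p s))"
    using e boundary_path_prepend[OF e(3) assms(2)] by (auto intro: boundary_path.edge)
  have eq: "t 0 = Some e \<and> (\<lambda>i. t (Suc i)) = prepend p s \<longleftrightarrow> t = case_nat (Some e) (prepend p s)" for t
    by (auto simp: fun_eq_iff split: nat.split)
  have "gen_act (Edge e) (\<lambda>x. if x = (head G e, prepend p s, n + int (length p)) then 1 else 0)
      = (\<lambda>x. if x = (tail G e, case_nat (Some e) (prepend p s), n + int (length (e # p))) then 1 else 0)"
  proof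
    fix x :: "'v \<times> (nat \<Rightarrow> 'e option) \<times> int"
    obtain y t m where x: "x = (y, t, m)"
      by (cases x)
    show "gen_act (Edge e) (\<lambda>x. if x = (head G e, prepend p s, n + int (length p)) then 1 else 0) x
        = (if x = (tail G e, case_nat (Some e) (prepend p s), n + int (length (e # p))) then 1 else 0)"
      using bp eq[of t] by (auto simp: x)
  qed
  then show ?case
    using Cons.IH[OF e(3)] e(2) by (simp add: word_act_def prepend_def)
qed

text \<open>Here \<open>long_paths 0 v\<close> consists of all real paths ending in v. For a
  boundary path s from w, the factor t sends the point mass at (w, s, 0) to one at v with boundary
  path ts. Each real path p in b then sends that mass to its own triple, so the value of the result
  at such a triple is the coefficient of p, and it is 0 because the kernel acts as 0.\<close>

lemma long_paths_independent:
  assumes b: "Poly_Mapping.keys b \<subseteq> long_paths 0 v" and t: "awalk v t w"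
    and J: "b * path_elem t w \<in> J"
  shows "b = 0"
proof (rule ccontr)
  assume "b \<noteq> 0"
  then obtain k where k: "k \<in> Poly_Mapping.keys b"
    by (auto simp: in_keys_iff poly_mapping_eq_iff fun_eq_iff)
  then obtain u p where p: "k = Word (map Edge p @ [Vertex v])" "awalk u p v"
    using b by (auto simp: long_paths_def)
  obtain s where s: "boundary_path w s"
    using t boundary_path_exists[of w] by auto
  let ?s = "prepend t s" and ?n = "int (length t)"
  have s': "boundary_path v ?s"
    using t s by (rule boundary_path_prepend)
  let ?d = "\<lambda>x. if x = (v, ?s, ?n) then 1 else 0"
  have "act (path_elem t w) (\<lambda>x. if x = (w, s, 0) then 1 else 0) = ?d"
    using path_act[OF t s, of 0] by (simp add: path_elem_def act_single)
  then have "act b ?d = (\<lambda>_. 0)"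
    using act_kernel[OF J] by (metis act_mult)
  moreover have "act b ?d (u, prepend p ?s, ?n + int (length p)) = Poly_Mapping.lookup b k"
  proof -
    have "word_act l ?d (u, prepend p ?s, ?n + int (length p)) = (if l = k then 1 else 0)"
      if l: "l \<in> Poly_Mapping.keys b" for l
    proof -
      obtain y q where q: "l = Word (map Edge q @ [Vertex v])" "awalk y q v"
        using subsetD[OF b l] unfolding long_paths_def by blast
      have "l = k \<longleftrightarrow> p = q"
        by (auto simp: p(1) q(1) inj_map_eq_map inj_def)
      \<comment> \<open>The integer coordinates give equal lengths, then the boundary paths give p =
        q; conversely a path with its endpoint determines its start.\<close>
      moreover have "(u, prepend p ?s, ?n + int (length p)) = (y, prepend q ?s, ?n + int (length q)) \<longleftrightarrow> p = q"
        using awalk_ends[OF p(2)] q(2) prepend_inject[of p ?s q] by auto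
      ultimately show ?thesis
        unfolding q(1) path_act[OF q(2) s'] by simp
    qed
    then have "act b ?d (u, prepend p ?s, ?n + int (length p)) =
        (\<Sum>l\<in>Poly_Mapping.keys b. if l = k then Poly_Mapping.lookup b l else 0)"
      unfolding act_def by (intro sum.cong) simp_all
    then show ?thesis
      using k by simp
  qed
  ultimately show False
    using k by (simp add: in_keys_iff)
qed

section \<open>Annihilators of vertex ideals\<close>


lemma vertex_ideal_conv: "vertex_ideal TYPE('k) G X = alg_genideal Q ((\<lambda>v. coset (vtx v)) ` X)"
  by (simp add: vertex_ideal_def leavitt_def leavitt_vertex_def[abs_def])

lemma
  assumes "X \<subseteq> verts G"
  shows alg_ideal_vertex_ideal: "alg_ideal Q (vertex_ideal TYPE('k) G X)"
    and vertex_in_vertex_ideal: "v \<in> X \<Longrightarrow> coset (vtx v) \<in> vertex_ideal TYPE('k) G X"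
proof -
  have "(\<lambda>v. coset (vtx v)) ` X \<subseteq> carrier Q"
    using assms by auto
  then show "alg_ideal Q (vertex_ideal TYPE('k) G X)"
    unfolding vertex_ideal_conv by (intro alg_ideal_genideal alg_ideal_quot_carrier)
  show "v \<in> X \<Longrightarrow> coset (vtx v) \<in> vertex_ideal TYPE('k) G X"
    unfolding vertex_ideal_conv by (rule subsetD[OF alg_genideal_superset imageI])
qed

lemma vertex_in_annihilator:
  assumes X: "X \<subseteq> verts G" "hereditary_set G X"
    and u: "u \<in> verts G" "\<not> path_geq_set G u X"
  shows "coset (vtx u) \<in> annihilator Q (vertex_ideal TYPE('k) G X)"
proof -
  \<comment> \<open>The factor a in the middle makes this a two-sided ideal: u a (b x) has the form
    u a' x. Hence it is enough to check the vertices in X.\<close>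
  let ?Z = "{x \<in> C. \<forall>a\<in>C. vtx u * a * x \<in> J \<and> x * a * vtx u \<in> J}"
  have "alg_ideal (free_alg (leavitt_gens G)) ?Z"
    unfolding alg_ideal_def free_alg_simps
  proof (intro conjI ballI allI)
    fix b x assume b: "b \<in> C" and x: "x \<in> ?Z"
    have xC: "x \<in> C" and ux: "vtx u * a * x \<in> J" and xu: "x * a * vtx u \<in> J" if "a \<in> C" for a
      using x that by simp_all
    have "vtx u * a * (b * x) \<in> J \<and> b * x * a * vtx u \<in> J" if a: "a \<in> C" for a
      using ux[OF C_closed(4)[OF a b]] J_closed(5)[OF b xu[OF a]] by (simp only: mult.assoc simp_thms)
    then show "b * x \<in> ?Z"
      using xC b by simp
    have "vtx u * a * (x * b) \<in> J \<and> x * b * a * vtx u \<in> J" if a: "a \<in> C" for a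
      using xu[OF C_closed(4)[OF b a]] J_closed(6)[OF ux[OF a] b] by (simp only: mult.assoc simp_thms)
    then show "x * b \<in> ?Z"
      using xC b by simp
  next
    fix x y assume "x \<in> ?Z" "y \<in> ?Z"
    then show "x + y \<in> ?Z"
      by (simp add: distrib_left distrib_right J_closed(3))
  next
    fix c x assume "x \<in> ?Z"
    then show "Poly_Mapping.map ((*) c) x \<in> ?Z"
      by (simp add: map_scale_mult J_closed(4))
  next
    show "?Z \<subseteq> C"
      by blast
    show "0 \<in> ?Z"
      by (simp add: J_closed(2))
  qed
  then have "alg_ideal Q (coset ` ?Z)"
    by (rule alg_ideal_coset_image)
  moreover have "vtx w \<in> ?Z" if w: "w \<in> X" for w
  proof -
    \<comment> \<open>A common descendant r would lie in X by heredity, and then u \<ge> X.\<close>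
    have uw: "\<not> path_geq G w r" if "path_geq G u r" for r
      using X(2) u(2) w that unfolding hereditary_set_def path_geq_set_def by blast
    then have wu: "\<not> path_geq G u r" if "path_geq G w r" for r
      using that by blast
    have "w \<in> verts G"
      using X(1) w by blast
    then have "vtx u * a * vtx w \<in> J \<and> vtx w * a * vtx u \<in> J" if "a \<in> C" for a
      using vtx_mult_vtx_in_kernel[OF that u(1) _ uw] vtx_mult_vtx_in_kernel[OF that _ u(1) wu] by blast
    then show ?thesis
      using \<open>w \<in> verts G\<close> by simp
  qed
  ultimately have Z: "vertex_ideal TYPE('k) G X \<subseteq> coset ` ?Z"
    unfolding vertex_ideal_conv by (intro alg_genideal_minimal) auto
  have "vtx u * x \<in> J \<and> x * vtx u \<in> J" if x: "x \<in> C" "coset x \<in> vertex_ideal TYPE('k) G X" for x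
  proof -
    obtain z where z: "z \<in> ?Z" "x \<approx> z"
      using subsetD[OF Z x(2)] unfolding image_iff coset_eq_iff cong_def by blast
    have zC: "z \<in> C" and ux: "vtx u * vtx u * z \<in> J" and xu: "z * vtx u * vtx u \<in> J"
      using z(1) u(1) by simp_all
    \<comment> \<open>There is no unit to put for the middle factor a, so a = u is taken and the
      idempotent u is then contracted.\<close>
    have uu: "vtx u \<approx> vtx u * vtx u"
      using leavitt_relations(1)[OF u(1) u(1)] by (simp add: cong_sym)
    have "vtx u * x \<approx> vtx u * vtx u * x"
      using uu x by (intro cong_mult_right)
    also have "\<dots> \<approx> vtx u * vtx u * z"
      using z(2) u(1) by (intro cong_mult_left) auto
    also have "\<dots> \<approx> 0"
      using ux by (simp add: cong_zero_iff)
    finally have left: "vtx u * x \<approx> 0" .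
    have "x * vtx u \<approx> x * (vtx u * vtx u)"
      using uu x by (intro cong_mult_left)
    also have "\<dots> \<approx> z * (vtx u * vtx u)"
      using z(2) u(1) by (intro cong_mult_right) auto
    also have "\<dots> = z * vtx u * vtx u"
      by (simp only: mult.assoc)
    also have "\<dots> \<approx> 0"
      using xu by (simp add: cong_zero_iff)
    finally have "x * vtx u \<approx> 0" .
    with left show ?thesis
      by (simp add: cong_zero_iff)
  qed
  then have "vtx u \<in> {a \<in> C. \<forall>x\<in>{x \<in> C. coset x \<in> vertex_ideal TYPE('k) G X}. a * x \<in> J \<and> x * a \<in> J}"
    using u(1) by simp
  moreover have "vertex_ideal TYPE('k) G X \<subseteq> carrier Q"
    using alg_ideal_vertex_ideal[OF X(1)] unfolding alg_ideal_def by (rule conjunct1)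
  ultimately show ?thesis
    by (simp only: annihilator_conv imageI)
qed


lemma annihilator_vertex_ideal:
  assumes X: "X \<subseteq> verts G" "hereditary_set G X"
  defines "Y \<equiv> {v \<in> verts G. \<not> path_geq_set G v X}"
  shows "annihilator Q (vertex_ideal TYPE('k) G X) = vertex_ideal TYPE('k) G Y"
proof
  have ideal_X: "alg_ideal Q (vertex_ideal TYPE('k) G X)"
    using X(1) by (rule alg_ideal_vertex_ideal)
  show "vertex_ideal TYPE('k) G Y \<subseteq> annihilator Q (vertex_ideal TYPE('k) G X)"
    unfolding vertex_ideal_conv[of Y]
    using vertex_in_annihilator[OF X] alg_ideal_annihilator[OF ideal_X]
    by (intro alg_genideal_minimal) (auto simp: Y_def)
next
  have Y: "Y \<subseteq> verts G"
    by (auto simp: Y_def)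
  \<comment> \<open>Preimages in the free algebra: ideals containing J, to which the reduction to
    long paths applies.\<close>
  define I where "I X = {a \<in> C. coset a \<in> vertex_ideal TYPE('k) G X}" for X
  have I: "alg_ideal (free_alg (leavitt_gens G)) (I X)" "J \<subseteq> I X" if "X \<subseteq> verts G" for X
    unfolding I_def using alg_ideal_vertex_ideal[OF that]
    by (rule alg_ideal_coset_vimage, rule J_subset_coset_vimage)
  have vtx_I: "vtx v \<in> I X" if "X \<subseteq> verts G" "v \<in> X" for X v
    using that vertex_in_vertex_ideal[OF that] by (simp add: I_def subset_iff)
  show "annihilator Q (vertex_ideal TYPE('k) G X) \<subseteq> vertex_ideal TYPE('k) G Y"
  proof
    fix z assume "z \<in> annihilator Q (vertex_ideal TYPE('k) G X)"
    moreover have "vertex_ideal TYPE('k) G X \<subseteq> carrier Q"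
      using alg_ideal_vertex_ideal[OF X(1)] unfolding alg_ideal_def by (rule conjunct1)
    ultimately have "z \<in> coset ` {a \<in> C. \<forall>x\<in>I X. a * x \<in> J \<and> x * a \<in> J}"
      unfolding I_def by (simp only: annihilator_conv)
    then obtain a where a: "z = coset a" "a \<in> C" and ann: "\<forall>x\<in>I X. a * x \<in> J \<and> x * a \<in> J"
      by (elim imageE CollectE conjE)
    obtain N where N: "\<And>v b. b \<in> spanned (long_paths N v) \<Longrightarrow> a * b \<in> spanned (long_paths 0 v)"
      using mult_long_paths[OF a(2)] by blast
    have "a \<in> I Y"
    proof (rule mem_ideal_if_long_paths[OF I(1,2)[OF Y] a(2), of N])
      fix u q v assume q: "awalk u q v" "N \<le> length q \<or> out_arcs G v = {}"
      have v: "v \<in> verts G"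
        using q by auto
      show "a * path_elem q v \<in> I Y"
      proof (cases "v \<in> Y")
        case True
        then show ?thesis
          using a(2) q(1) by (intro ideal_closed(5)[OF I(1)[OF Y]] path_elem_mem_ideal[OF I(1,2)[OF Y]] vtx_I[OF Y])
      next
        case False
        then obtain t w where t: "w \<in> X" "awalk v t w"
          using v by (auto simp: Y_def path_geq_set_def path_geq_def)
        have "a * path_elem q v \<in> spanned (long_paths 0 v)"
          using q by (intro N path_elem_spanned)
        then obtain b where b: "Poly_Mapping.keys b \<subseteq> long_paths 0 v" "a * path_elem q v \<approx> b"
          by (auto simp: spanned_def)
        \<comment> \<open>The path t ends in X, so q t lies in the ideal that a annihilates. This
          turns the hypothesis on a into a statement about b t.\<close>
        have "path_elem q v * path_elem t w \<in> I X"
          using q(1) t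
          by (intro ideal_closed(5)[OF I(1)[OF X(1)]] path_elem_mem_ideal[OF I(1,2)[OF X(1)]] vtx_I[OF X(1)]) auto
        then have "a * path_elem q v * path_elem t w \<in> J"
          using ann by (simp only: mult.assoc)
        moreover have "b * path_elem t w \<approx> a * path_elem q v * path_elem t w"
          using t(2) by (intro cong_mult_right cong_sym[OF b(2)]) auto
        ultimately have "b * path_elem t w \<in> J"
          by (blast intro: cong_mem_ideal[OF ideal subset_refl])
        then have "b = 0"
          using b(1) t(2) by (intro long_paths_independent)
        then have "a * path_elem q v \<in> J"
          using b(2) by (simp add: cong_zero_iff)
        then show ?thesis
          using I(2)[OF Y] by blast
      qed
    qed
    then show "z \<in> vertex_ideal TYPE('k) G Y"
      by (simp add: I_def a(1))
  qed
qed

end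

lemma annihilator_leavitt_vertex_ideal:
  fixes E :: "('v, 'e) pre_digraph"
  assumes "hersat_point_functor H" "row_finite_digraph E"
  shows "annihilator (leavitt TYPE('k::field) E) (vertex_ideal TYPE('k) E (H E))
    = vertex_ideal TYPE('k) E (ext H E)"
proof -
  interpret leavitt_graph E "TYPE('k)"
    using assms(2) by (simp add: leavitt_graph_def)
  have "H E \<subseteq> verts E" "hereditary_set E (H E)"
    using assms by (simp_all add: hersat_point_functor_def point_functor_def hereditary_functor_def)
  from annihilator_vertex_ideal[OF this] show ?thesis
    unfolding leavitt_def ext_def .
qed

section \<open>The functor ext\<close>

lemma (in wf_digraph) path_geq_refl: "v \<in> verts G \<Longrightarrow> path_geq G v v"
  unfolding path_geq_def by (intro exI[of _ "[]"]) (simp add: awalk_Nil_iff)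

lemma (in wf_digraph) path_geq_trans: "path_geq G u v \<Longrightarrow> path_geq G v w \<Longrightarrow> path_geq G u w"
  unfolding path_geq_def using awalk_appendI by blast

lemma (in wf_digraph) path_geq_in_verts: "path_geq G u v \<Longrightarrow> u \<in> verts G \<and> v \<in> verts G"
  unfolding path_geq_def by auto

text \<open>Heredity of \<open>ext H\<close> is transitivity of \<ge>. Its saturation rests on the
  heredity of H, and its compatibility with an isomorphism rests on that of H with the
  inverse.\<close>

lemma hersat_point_functor_ext:
  fixes H :: "('v, 'e) graph_points"
  assumes "hersat_point_functor H"
  shows "hersat_point_functor (ext H)"
  unfolding hersat_point_functor_def point_functor_def hereditary_functor_def saturated_functor_def
proof (intro conjI allI impI)
  fix E F :: "('v, 'e) pre_digraph" and h
  assume "row_finite_digraph E \<and> row_finite_digraph F \<and> graph_iso E F h"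
  then have E: "row_finite_digraph E" and F: "row_finite_digraph F"
    and h: "pre_digraph.digraph_isomorphism E h" "F = app_iso h E"
    by (auto simp: graph_iso_def)
  interpret row_finite_digraph E by (rule E)
  interpret F: row_finite_digraph F by (rule F)
  \<comment> \<open>A path from x to a point of H(F) is pulled back along h. Its endpoint lands in
    H(E) because H respects the inverse isomorphism.\<close>
  have inv: "graph_iso F E (inv_iso h)"
    using h digraph_isomorphism_invI[OF h(1)] by (simp add: graph_iso_def)
  show "iso_verts h ` ext H E \<subseteq> ext H F"
  proof
    fix x assume "x \<in> iso_verts h ` ext H E"
    then obtain v where v: "x = iso_verts h v" "v \<in> verts E" "\<not> path_geq_set E v (H E)"
      by (auto simp: ext_def)
    have "\<not> path_geq F x w" if w: "w \<in> H F" for w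
    proof
      assume "path_geq F x w"
      then obtain p where "pre_digraph.awalk (app_iso h E) x p w"
        using h(2) by (auto simp: path_geq_def)
      from awalk_app_isoD[OF this h(1)] have "path_geq E v (iso_verts (inv_iso h) w)"
        using v h(1) by (auto simp: path_geq_def)
      moreover have "iso_verts (inv_iso h) w \<in> H E"
        using assms E F inv w unfolding hersat_point_functor_def point_functor_def by blast
      ultimately show False
        using v(3) by (auto simp: path_geq_set_def)
    qed
    then show "x \<in> ext H F"
      using v h(2) by (auto simp: ext_def path_geq_set_def)
  qed
next
  fix E :: "('v, 'e) pre_digraph"
  assume E: "row_finite_digraph E"
  interpret row_finite_digraph E by (rule E)
  have her: "hereditary_set E (H E)"
    using assms E by (simp add: hersat_point_functor_def hereditary_functor_def)
  show "ext H E \<subseteq> verts E"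
    by (auto simp: ext_def)
  show "hereditary_set E (ext H E)"
    unfolding hereditary_set_def
  proof (intro allI impI, elim conjE)
    fix v w assume v: "v \<in> ext H E" and vw: "path_geq E v w"
    have "\<not> path_geq E w x" if "x \<in> H E" for x
      using path_geq_trans[OF vw, of x] v that by (auto simp: ext_def path_geq_set_def)
    then show "w \<in> ext H E"
      using path_geq_in_verts[OF vw] by (auto simp: ext_def path_geq_set_def)
  qed
  show "saturated_set E (ext H E)"
    unfolding saturated_set_def
  proof (intro allI impI, elim conjE)
    fix v assume reg: "regular_vertex E v" and sub: "head E ` out_arcs E v \<subseteq> ext H E"
    have "\<not> path_geq E v w" if w: "w \<in> H E" for w
    proof
      assume "path_geq E v w"
      then obtain p where p: "awalk v p w"
        by (auto simp: path_geq_def)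
      \<comment> \<open>e is the first edge of p. If p is empty, v itself is in H(E), and any edge
        leaving the regular vertex v will do by heredity.\<close>
      obtain e where e: "e \<in> out_arcs E v" "path_geq_set E (head E e) (H E)"
      proof (cases p)
        case Nil
        then have "v = w"
          using p by (simp add: awalk_Nil_iff)
        obtain e where e: "e \<in> out_arcs E v"
          using reg unfolding regular_vertex_def by blast
        then have "path_geq E v (head E e)"
          unfolding path_geq_def using arc_implies_awalk[of e] by auto
        then have "head E e \<in> H E"
          using her w \<open>v = w\<close> unfolding hereditary_set_def by blast
        moreover have "path_geq E (head E e) (head E e)"
          using e by (intro path_geq_refl) auto
        ultimately show ?thesis
          using that[OF e] by (auto simp: path_geq_set_def)
      next
        case (Cons e q)
        then show ?thesis
          using p w by (intro that[of e]) (auto simp: awalk_Cons_iff path_geq_set_def path_geq_def)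
      qed
      then show False
        using subsetD[OF sub imageI[OF e(1)]] by (simp add: ext_def)
    qed
    then show "v \<in> ext H E"
      using reg by (auto simp: ext_def path_geq_set_def regular_vertex_def)
  qed
qed

section \<open>Ring isomorphisms\<close>

text \<open>\<open>iso\<close> demands only a bijection that respects sums. So f(0) = 0 is derived
  from f(0) = f(0) + f(0): for a representative c of f(0), the difference c - (c + c) = - c lies in
  the kernel.\<close>

lemma rng_iso_leavitt_zero:
  fixes E F :: "('v, 'e) pre_digraph"
  assumes "row_finite_digraph E" "row_finite_digraph F"
    and f: "f \<in> rng_iso (leavitt TYPE('k::field) E) (leavitt TYPE('k) F)"
  shows "f (zero (leavitt TYPE('k) E)) = zero (leavitt TYPE('k) F)"
proof -
  interpret E: leavitt_graph E "TYPE('k)"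
    using assms(1) by (simp add: leavitt_graph_def)
  interpret F: leavitt_graph F "TYPE('k)"
    using assms(2) by (simp add: leavitt_graph_def)
  have zero: "E.coset 0 \<in> carrier E.Q"
    by auto
  have f': "f \<in> iso (add_monoid E.Q) (add_monoid F.Q)"
    using f by (simp add: rng_iso_def leavitt_def)
  then have hom: "f (add E.Q x y) = add F.Q (f x) (f y)" if "x \<in> carrier E.Q" "y \<in> carrier E.Q" for x y
    using hom_mult[of f "add_monoid E.Q" "add_monoid F.Q" x y] that by (simp add: iso_def)
  have "f ` carrier E.Q = carrier F.Q"
    using f' by (simp add: iso_def bij_betw_def)
  with imageI[OF zero, of f] have "f (E.coset 0) \<in> F.coset ` F.C"
    by (simp only: F.coset_carrier)
  then obtain c where c: "f (E.coset 0) = F.coset c"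
    by (elim imageE)
  have "F.coset c = F.coset (c + c)"
    using hom[OF zero zero] by (simp only: c E.coset_add F.coset_add add_0_left)
  then have "- c \<in> F.J"
    by (simp add: F.coset_eq_iff)
  then have "F.coset c = F.coset 0"
    using F.J_closed(7)[of "- c"] by (simp add: F.coset_eq_iff)
  with c show ?thesis
    by (simp add: leavitt_def E.coset_zero F.coset_zero)
qed

text \<open>As f is injective and maps zero to zero, a product vanishes exactly if the product of
  the images does; surjectivity reaches all of B.\<close>

lemma rng_iso_image_annihilator:
  assumes f: "f \<in> rng_iso A B" and zero: "f (zero A) = zero B" "zero A \<in> carrier A"
    and closed: "\<And>x y. x \<in> carrier A \<Longrightarrow> y \<in> carrier A \<Longrightarrow> mult A x y \<in> carrier A"
    and I: "I \<subseteq> carrier A"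
  shows "f ` annihilator A I = annihilator B (f ` I)"
proof -
  have bij: "inj_on f (carrier A)" "f ` carrier A = carrier B"
    and mult: "\<And>x y. x \<in> carrier A \<Longrightarrow> y \<in> carrier A \<Longrightarrow> f (mult A x y) = mult B (f x) (f y)"
    using f by (simp_all add: rng_iso_def iso_def bij_betw_def hom_mult)
  have zero_iff: "mult B (f x) (f y) = zero B \<longleftrightarrow> mult A x y = zero A"
    if "x \<in> carrier A" "y \<in> carrier A" for x y
    using inj_on_eq_iff[OF bij(1) closed[OF that] zero(2)] by (simp add: mult[OF that] zero(1))
  have "(\<forall>y\<in>f ` I. mult B (f a) y = zero B \<and> mult B y (f a) = zero B) \<longleftrightarrow>
      (\<forall>x\<in>I. mult A a x = zero A \<and> mult A x a = zero A)" if "a \<in> carrier A" for a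
    using zero_iff[OF that subsetD[OF I]] zero_iff[OF subsetD[OF I] that] by simp
  then show ?thesis
    unfolding annihilator_def bij(2)[symmetric] by auto
qed

text \<open>The annihilator depends on multiplication and zero alone, so f transports it, and on the
  ideals in question taking annihilators amounts to applying \<open>ext\<close>.\<close>

lemma f_related_ext:
  fixes E F :: "('v, 'e) pre_digraph"
    and f :: "('v, 'e, 'k::field) leavitt_elem \<Rightarrow> ('v, 'e, 'k) leavitt_elem"
  assumes E: "row_finite_digraph E" and F: "row_finite_digraph F"
    and f: "f \<in> rng_iso (leavitt TYPE('k) E) (leavitt TYPE('k) F)"
    and H: "hersat_point_functor H1" "hersat_point_functor H2" "f_related f E F H1 H2"
  shows "f_related f E F (ext H1) (ext H2)"
proof -
  interpret leavitt_graph E "TYPE('k)"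
    using E by (simp add: leavitt_graph_def)
  have "H1 E \<subseteq> verts E"
    using H(1) E by (simp add: hersat_point_functor_def point_functor_def)
  then have I: "alg_ideal Q (vertex_ideal TYPE('k) E (H1 E))"
    by (rule alg_ideal_vertex_ideal)
  have "f ` annihilator (leavitt TYPE('k) E) (vertex_ideal TYPE('k) E (H1 E)) =
      annihilator (leavitt TYPE('k) F) (f ` vertex_ideal TYPE('k) E (H1 E))"
  proof (rule rng_iso_image_annihilator[OF f rng_iso_leavitt_zero[OF E F f]])
    show "zero (leavitt TYPE('k) E) \<in> carrier (leavitt TYPE('k) E)"
      "vertex_ideal TYPE('k) E (H1 E) \<subseteq> carrier (leavitt TYPE('k) E)"
      using alg_ideal_quot_carrier I unfolding leavitt_def alg_ideal_def by simp_all
    show "mult (leavitt TYPE('k) E) x y \<in> carrier (leavitt TYPE('k) E)"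
      if "x \<in> carrier (leavitt TYPE('k) E)" "y \<in> carrier (leavitt TYPE('k) E)" for x y
      using alg_ideal_quot_carrier that unfolding leavitt_def alg_ideal_def by blast
  qed
  then show ?thesis
    using H E F by (simp add: f_related_def annihilator_leavitt_vertex_ideal)
qed

theorem proposition3p6:
  fixes H :: "('v, 'e) graph_points"
  assumes "hersat_point_functor H"
  shows
    "hersat_point_functor (ext H) \<and>
     (\<forall>E. row_finite_digraph E \<longrightarrow>
        annihilator (leavitt TYPE('k::field) E) (vertex_ideal TYPE('k) E (H E))
          = vertex_ideal TYPE('k) E (ext H E)) \<and>
     (hersat_point_functor (ext (ext H)) \<and>
      (\<forall>E. row_finite_digraph E \<longrightarrow>
         annihilator (leavitt TYPE('k) E)
             (annihilator (leavitt TYPE('k) E) (vertex_ideal TYPE('k) E (H E)))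
           = vertex_ideal TYPE('k) E (ext (ext H) E))) \<and>
     (\<forall>E. row_finite_digraph E \<longrightarrow>
        ext (ext H) E \<subseteq> {v \<in> verts E. path_geq_set E v (H E)}) \<and>
     (\<forall>E. row_finite_digraph E \<longrightarrow> H E \<subseteq> ext (ext H) E) \<and>
     (\<forall>E. row_finite_digraph E \<longrightarrow>
        (ext (ext H) E \<subseteq> H E \<longleftrightarrow>
         (\<forall>v\<in>verts E. (\<forall>w\<in>verts E. \<not> path_geq_set E w (H E) \<longrightarrow> \<not> path_geq E v w)
            \<longrightarrow> v \<in> H E))) \<and>
     (\<forall>(E :: ('v, 'e) pre_digraph) (F :: ('v, 'e) pre_digraph) f.
        row_finite_digraph E \<and> row_finite_digraph F \<and>
        f \<in> rng_iso (leavitt TYPE('k) E) (leavitt TYPE('k) F) \<longrightarrow>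
        (\<forall>H1 H2. hersat_point_functor H1 \<and> hersat_point_functor H2 \<and> f_related f E F H1 H2
           \<longrightarrow> f_related f E F (ext H1) (ext H2)) \<and>
        (\<forall>H'. hersat_point_functor H' \<and> f_invariant f E F H'
           \<longrightarrow> f_invariant f E F (ext H')))"
proof -
  note ext = hersat_point_functor_ext[OF assms]
  \<comment> \<open>A vertex v that is not above H(E) lies in \<open>ext H E\<close>, and v \<ge> v
    keeps it out of \<open>ext (ext H) E\<close>.\<close>
  have geq: "ext (ext H) E \<subseteq> {v \<in> verts E. path_geq_set E v (H E)}" if "row_finite_digraph E" for E
  proof -
    interpret row_finite_digraph E by (rule that)
    show ?thesis
      using path_geq_refl unfolding ext_def path_geq_set_def by blast
  qed
  \<comment> \<open>Descendants of H(E) stay in H(E) by heredity, and no point of H(E) lies in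
    \<open>ext H E\<close>.\<close>
  have sub: "H E \<subseteq> ext (ext H) E" if E: "row_finite_digraph E" for E
  proof -
    interpret row_finite_digraph E by (rule E)
    have "H E \<subseteq> verts E" "hereditary_set E (H E)"
      using assms E by (simp_all add: hersat_point_functor_def point_functor_def hereditary_functor_def)
    then show ?thesis
      using path_geq_refl unfolding ext_def path_geq_set_def hereditary_set_def by blast
  qed
  have iff: "ext (ext H) E \<subseteq> H E \<longleftrightarrow>
      (\<forall>v\<in>verts E. (\<forall>w\<in>verts E. \<not> path_geq_set E w (H E) \<longrightarrow> \<not> path_geq E v w) \<longrightarrow> v \<in> H E)" for E
  proof -
    have "v \<in> ext (ext H) E \<longleftrightarrow>
        v \<in> verts E \<and> (\<forall>w\<in>verts E. \<not> path_geq_set E w (H E) \<longrightarrow> \<not> path_geq E v w)" for v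
      unfolding ext_def[of "ext H"] path_geq_set_def[of E _ "ext H E"] by (auto simp: ext_def)
    then show ?thesis
      unfolding subset_iff by blast
  qed
  have ann: "annihilator (leavitt TYPE('k) E) (vertex_ideal TYPE('k) E (H E)) = vertex_ideal TYPE('k) E (ext H E)"
    if "row_finite_digraph E" for E
    using assms that by (rule annihilator_leavitt_vertex_ideal)
  have ann2: "annihilator (leavitt TYPE('k) E)
      (annihilator (leavitt TYPE('k) E) (vertex_ideal TYPE('k) E (H E))) = vertex_ideal TYPE('k) E (ext (ext H) E)"
    if "row_finite_digraph E" for E
    unfolding ann[OF that] using ext that by (rule annihilator_leavitt_vertex_ideal)
  show ?thesis
    unfolding f_invariant_def
    by (intro conjI allI impI ext hersat_point_functor_ext[OF ext] geq sub iff ann ann2; (elim conjE)?)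
      (assumption | rule f_related_ext)+
qed

end
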